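(* Let $\gamma$ be an intersection context, $\sigma$ a conflict-free intersection policy for $\gamma$, and $\mathit{next}:\mathcal H_\gamma\to\mathcal L_{in}$ a function. If $\gamma$ is synchronous, $\mathit{next}$-aware and $\sigma$-aware, then there exists a unique (up to behavior on unreachable states) implementation $P$ of the knowledge-based program $\mathbf P$ (defined from $\sigma$ and $\mathit{next}$) with respect to $\gamma$, and this $P$ satisfies Safety and Validity, is lexicographically optimal with respect to $\gamma$, and lexicographically dominates the unique implementation of $\mathbf P^\sigma$ with respect to $\gamma$. Moreover, if $\sigma$ is fair, then $P$ satisfies Liveness.
   Context: **Setting.** $\mathrm{Ag}\subseteq\mathbb N$ is a (possibly infinite) set of agents. Lanes $\mathcal L=\{0,\dots,\ell-1\}$ are partitioned into incoming lanes $\mathcal L_{in}=\{0,\dots,k-1\}$ ($1<k<\ell$) and outgoing lanes $\mathcal L_{out}$. A move is an element of $\mathcal L_{in}\times\mathcal L_{out}$. A symmetric relation $\mathcal O\subseteq(\mathcal L_{in}\times\mathcal L_{out})^2$ is fixed; two moves are compatible if the pair is in $\mathcal O$. **Adversaries.** A transmission environment is $T\subseteq(\mathcal L_{in}\times\mathbb N)^2$ with $((l,0),(l',0))\in T$ for all $l,l'\in\mathcal L_{in}$. An adversary is $\alpha=(\tau,T,F_t,F_r)$ with $\tau:\mathrm{Ag}\to\mathbb N\times\mathcal L_{in}\times\mathcal L_{out}$ (arrival time, arrival lane, intended departure lane), where distinct agents with the same arrival time have different arrival lanes; $T$ a transmission environment; $F_t,F_r:\mathbb N\times\mathrm{Ag}\to\{0,1\}$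 (value $0$ at $(m,i)$: $i$'s transmitter, resp. receiver, fails in round $m+1$, i.e. between times $m$ and $m+1$). An adversary model $\mathcal F$ is a set of adversaries. **Intersection contexts.** An environment state is $s_e=(\alpha,t,(q_l)_{l\in\mathcal L_{in}},\mathit{done})$: an adversary $\alpha\in\mathcal F$, a time $t\in\mathbb N$, a queue $q_l$ of agents per incoming lane, and a set $\mathit{done}\subseteq\mathrm{Ag}$. $\mathit{pos}_i=p$ if $i$ is in position $p$ of some queue (front is position $0$), $\top$ if $i\in\mathit{done}$, $\bot$ otherwise. Agent $i$'s sensor reading $\mathscr S_i(s_e)\in\Sigma_i$ contains $\mathit{front}_i$ ($=1$ iff $\mathit{pos}_i=0$), $\mathit{lane}_i$ ($=l$ if $i$ is in $q_l$, $\top$ if $i\in\mathit{done}$, $\bot$ otherwise) and $\mathit{intent}_i$ (the departure lane in $\tau(i)$), and possibly further components that are functions of $s_e$ (such as the time). An information-exchange protocol $\mathcal E$ gives for each agent $i$: a set $\mathit{Mem}_i$ of memory states with a subset of initial ones, local states $L_i=\mathit{Mem}_i\times\Sigma_i$, actions $A_i=\{\mathtt{go},\mathtt{noop}\}$, messages $M_i$, $\mu_i:L_i\times A_i\times\Sigma_i\to M_i\cup\{\bot\}$ ($\bot$: no message) and $\delta_i:L_i\times A_i\times\mathcal P(\bigcup_jM_j)\to\mathit{Mem}_i$. An intersection context is $\gamma=(\mathcal E,\mathcal F,\pi)$, where $\pi$ interprets atomic propositions about $\mathit{front}_i,\mathit{lane}_i,\mathit{intent}_i,\mathit{pos}_i$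 according to the global state. An action protocol $P$ for $\gamma$ consists of maps $P_i:L_i\to A_i$; $\mathtt{go}$ can be performed only by an agent at the front of its queue ($P_i(s)=\mathtt{go}$ only if $\mathit{front}_i=1$ in $s$). **Runs.** Global states are $(s_e,(s_i)_{i\in\mathrm{Ag}})$. Initially $t=0$, all queues and $\mathit{done}$ are empty, and $s_i=(u_i,\mathscr S_i(s_e))$ with $u_i$ an initial memory state. In round $m+1$: each $i$ performs $P_i(s_i)$; each agent at the front of a queue performing $\mathtt{go}$ is dequeued and added to $\mathit{done}$; then each agent $i$ with $\tau(i)=(m+1,l,l')$ is appended to $q_l$; time becomes $m+1$ and $\alpha$ is unchanged, giving $s_e'$. Each $i$ broadcasts $m_i=\mu_i(s_i,P_i(s_i),\mathscr S_i(s_e'))$. $B_i=\emptyset$ if $i$ is in no queue in $s'_e$ or $F_r(m,i)=0$; otherwise $B_i$ is the set of (non-$\bot$) $m_j$ for agents $j$ in some queue with ((lane, position) of $j$, (lane, position) of $i$)$\,\in T$ (in $s'_e$) and $F_t(m,j)=1$. The new local state is $s_i'=(\delta_i(s_i,P_i(s_i),B_i),\mathscr S_i(s'_e))$. $\mathcal I_{\gamma,P}$ is the interpreted system of all such runs $r:\mathbb N\to$ global states; $r_i(m)$ is $i$'s local state at point $(r,m)$. $K_i\phi$ holds at $(r,m)$ iff $\phi$ holds at all points $(r',m')$ with $r'_i(m')=r_i(m)$; $\bigcirc\phi$ holds at $(r,m)$ iff $\phi$ holds at $(r,m+1)$; $\Diamond\phi$ iff $\phi$ holds at some $(r,m')$,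 $m'\ge m$. A formula is valid in $\mathcal I$ ($\mathcal I\models\phi$) if it holds at all points. $\gamma$ is synchronous if for every protocol $P$, points $(r,m),(r',m')$ of $\mathcal I_{\gamma,P}$ and agent $i$, $r_i(m)=r'_i(m')$ implies $m=m'$. **Intersection protocol.** $\mathit{going}_i:=\mathit{front}_i\wedge\bigcirc\neg\mathit{front}_i$. $P$ is an intersection protocol for $\gamma$ if for all $i\ne j$ these are valid in $\mathcal I_{\gamma,P}$: Validity $\mathit{going}_i\Rightarrow\mathit{front}_i$; Safety $(\mathit{going}_i\wedge\mathit{going}_j)\Rightarrow((\mathit{lane}_i,\mathit{intent}_i),(\mathit{lane}_j,\mathit{intent}_j))\in\mathcal O$; Liveness $\mathit{front}_i\Rightarrow\Diamond\mathit{going}_i$. **Lexicographic optimality.** $GO(r,m)$ is the set of agents $i$ with $\mathit{going}_i$ true at $(r,m)$. Runs $r$ of $\mathcal I_{\gamma,P}$ and $r'$ of $\mathcal I_{\gamma,P'}$ correspond if $r(0)=r'(0)$. $P$ lexicographically dominates $P'$ w.r.t. $\gamma$ if for all corresponding runs $r$ of $P$ and $r'$ of $P'$, either $GO(r,m)=GO(r',m)$ for all $m$, or at the first $m$ with $GO(r,m)\neq GO(r',m)$ we have $GO(r',m)\subsetneq GO(r,m)$; strictly if also $P'$ does not lexicographically dominate $P$. $P$ is lexicographically optimal w.r.t. $\gamma$ if no intersection protocol for $\gamma$ strictly lexicographically dominates $P$. **Policies.** For an adversary $\alpha=(\tau,T,F_t,F_r)$ and $m\in\mathbb N$, $\alpha_m=(\tau^m,T,F_r^m,F_t^m)$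 with $\tau^m=\{(i,l,l'):\tau(i)=(m+1,l,l')\}$ and $F_a^m(i)=F_a(m,i)$ for $a\in\{r,t\}$. $H(\alpha,m)=\langle\alpha_0,\dots,\alpha_{m-1}\rangle$; $H(r,m)=H(\alpha,m)$ if $r$ has adversary $\alpha$. $\mathcal H_\gamma$ is the set of all $H(\alpha,m)$ with $\alpha\in\mathcal F$, $m\ge0$. An intersection policy for $\gamma$ is a map $\sigma:\mathcal H_\gamma\to\mathcal P(\mathcal L_{in}\times\mathcal L_{out})$. It is conflict-free if for every $h\in\mathcal H_\gamma$ any two distinct moves in $\sigma(h)$ are compatible. It is fair if for every $\alpha\in\mathcal F$, every move $(l,l')$ and every $m\ge0$ there is $m'\ge m$ with $(l,l')\in\sigma(H(\alpha,m'))$. In formulas, $\sigma$ and $\mathit{next}$ at $(r,m)$ denote $\sigma(H(r,m))$ and $\mathit{next}(H(r,m))$. $\gamma$ is $\sigma$-aware if for all protocols $P$ for $\gamma$, agents $i$, $l\in\mathcal L_{in}$, $l'\in\mathcal L_{out}$: $\mathcal I_{\gamma,P}\models((l,l')\in\sigma\wedge\mathit{lane}_i=l)\Rightarrow K_i((l,l')\in\sigma)$. $\gamma$ is $\mathit{next}$-aware if for all protocols $P$ for $\gamma$, agents $i$, $l\in\mathcal L_{in}$: $\mathcal I_{\gamma,P}\models\mathit{next}=l\Rightarrow K_i(\mathit{next}=l)$. **Knowledge-based programs.** $\mathbf P^\sigma$: agent $i$ does "if $K_i(\mathit{front}_i\wedge(\mathit{lane}_i,\mathit{intent}_i)\in\sigma)$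 then $\mathtt{go}$ else $\mathtt{noop}$". $\mathbf P$: agent $i$ does "if $K_i(\mathit{front}_i\wedge((\mathit{lane}_i,\mathit{intent}_i)\in\sigma\vee V_i))$ then $\mathtt{go}$ else $\mathtt{noop}$", where $V_i$ is the proposition: $(\mathit{lane}_i,\mathit{intent}_i)\notin\sigma$ and the move $(\mathit{lane}_i,\mathit{intent}_i)$ is compatible with (a) all moves $(\mathit{lane}_j,\mathit{intent}_j)\in\sigma$ of agents $j$ for which $\mathit{going}_j$ holds, and (b) all moves $(\mathit{lane}_j,\mathit{intent}_j)\notin\sigma$ of agents $j\ne i$ for which $\mathit{going}_j$ holds and $\mathit{lane}_j\in[\mathit{next},\mathit{lane}_i)$. Here $[a,b)$ is the cyclic interval of lanes $a,a+1,\dots,b-1$ modulo $|\mathcal L_{in}|$ (empty if $a=b$). An action protocol $P$ implements a program "if $K_i\phi_i$ then $\mathtt{go}$ else $\mathtt{noop}$" w.r.t. $\gamma$ if for all points $(r,m)$ of $\mathcal I_{\gamma,P}$ and all $i$: $P_i(r_i(m))=\mathtt{go}$ iff $K_i\phi_i$ holds at $(r,m)$ in $\mathcal I_{\gamma,P}$. Uniqueness of implementations means any two take the same actions at all reachable local states. *)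

theory Defs
  imports Main "HOL-Library.FuncSet"
begin

type_synonym agent = nat
type_synonym lane = nat
type_synonym move = "lane \<times> lane"

datatype action = Go | Noop

text \<open>Values of \<open>pos\<close> and \<open>lane\<close>: \<open>Top\<close> for agents that have passed the intersection,
  \<open>Bot\<close> for agents that have not yet arrived.\<close>

datatype 'a ext = Val 'a | Top | Bot

text \<open>Functions indexed by agents are extensional on the agent set (value \<open>undefined\<close> elsewhere),
  so that equality of adversaries, histories and global states is the intended one.
  For the failure functions, \<open>False\<close> means that the device fails.\<close>

record adversary =
  arrival :: "agent \<Rightarrow> nat \<times> lane \<times> lane"
  transmission :: "((lane \<times> nat) \<times> (lane \<times> nat)) set"
  Ft :: "nat \<Rightarrow> agent \<Rightarrow> bool"
  Fr :: "nat \<Rightarrow> agent \<Rightarrow> bool"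

record env_state =
  adv :: adversary
  time :: nat
  queue :: "lane \<Rightarrow> agent list"
  departed :: "agent set"

text \<open>\<open>extra\<close> collects all sensor components beyond the three mandatory ones.\<close>

record 'x reading =
  front_s :: bool
  lane_s :: "lane ext"
  intent_s :: lane
  extra_s :: 'x

type_synonym ('u, 'x) local_state = "'u \<times> 'x reading"
type_synonym ('u, 'x) global_state = "env_state \<times> (agent \<Rightarrow> ('u, 'x) local_state)"
type_synonym ('u, 'x) run = "nat \<Rightarrow> ('u, 'x) global_state"
type_synonym ('u, 'x) protocol = "agent \<Rightarrow> ('u, 'x) local_state \<Rightarrow> action"

text \<open>Formulas are embedded shallowly, as predicates on points \<open>(r, m)\<close>.\<close>

type_synonym ('u, 'x) formula = "('u, 'x) run \<Rightarrow> nat \<Rightarrow> bool"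

text \<open>An intersection context, bundled with the fixed data of the intersection.  The interpretation
  of the atomic propositions is the canonical one, given by \<open>front\<close>, \<open>lane_of\<close>, \<open>intent\<close> and
  \<open>pos\<close> below.  In \<open>mu\<close>, the result \<open>None\<close> means that no message is sent.\<close>

record ('u, 'x, 'g) int_context =
  agents :: "agent set"
  n_in :: nat
  n_lanes :: nat
  compat :: "(move \<times> move) set"
  mem :: "agent \<Rightarrow> 'u set"
  init_mem :: "agent \<Rightarrow> 'u set"
  readings :: "agent \<Rightarrow> 'x reading set"
  extra :: "agent \<Rightarrow> env_state \<Rightarrow> 'x"
  msgs :: "agent \<Rightarrow> 'g set"
  mu :: "agent \<Rightarrow> ('u, 'x) local_state \<Rightarrow> action \<Rightarrow> 'x reading \<Rightarrow> 'g option"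
  delta :: "agent \<Rightarrow> ('u, 'x) local_state \<Rightarrow> action \<Rightarrow> 'g set \<Rightarrow> 'u"
  model :: "adversary set"

definition lanes_in :: "('u, 'x, 'g) int_context \<Rightarrow> lane set" where
  "lanes_in \<gamma> = {0..<n_in \<gamma>}"

definition lanes_out :: "('u, 'x, 'g) int_context \<Rightarrow> lane set" where
  "lanes_out \<gamma> = {n_in \<gamma>..<n_lanes \<gamma>}"

definition moves :: "('u, 'x, 'g) int_context \<Rightarrow> move set" where
  "moves \<gamma> = lanes_in \<gamma> \<times> lanes_out \<gamma>"

definition transmission_environment ::
    "('u, 'x, 'g) int_context \<Rightarrow> ((lane \<times> nat) \<times> (lane \<times> nat)) set \<Rightarrow> bool" where
  "transmission_environment \<gamma> T \<longleftrightarrow>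
     T \<subseteq> (lanes_in \<gamma> \<times> UNIV) \<times> (lanes_in \<gamma> \<times> UNIV) \<and>
     (\<forall>l\<in>lanes_in \<gamma>. \<forall>l'\<in>lanes_in \<gamma>. ((l, 0), (l', 0)) \<in> T)"

definition is_adversary :: "('u, 'x, 'g) int_context \<Rightarrow> adversary \<Rightarrow> bool" where
  "is_adversary \<gamma> \<alpha> \<longleftrightarrow>
     arrival \<alpha> \<in> agents \<gamma> \<rightarrow>\<^sub>E UNIV \<times> lanes_in \<gamma> \<times> lanes_out \<gamma> \<and>
     (\<forall>i\<in>agents \<gamma>. \<forall>j\<in>agents \<gamma>. i \<noteq> j \<and> fst (arrival \<alpha> i) = fst (arrival \<alpha> j) \<longrightarrow>
        fst (snd (arrival \<alpha> i)) \<noteq> fst (snd (arrival \<alpha> j))) \<and>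
     transmission_environment \<gamma> (transmission \<alpha>) \<and>
     (\<forall>m. Ft \<alpha> m \<in> extensional (agents \<gamma>) \<and> Fr \<alpha> m \<in> extensional (agents \<gamma>))"

definition env_states :: "('u, 'x, 'g) int_context \<Rightarrow> env_state set" where
  "env_states \<gamma> = {s. adv s \<in> model \<gamma> \<and>
     (\<forall>l\<in>lanes_in \<gamma>. set (queue s l) \<subseteq> agents \<gamma>) \<and>
     (\<forall>l. l \<notin> lanes_in \<gamma> \<longrightarrow> queue s l = []) \<and>
     departed s \<subseteq> agents \<gamma>}"

text \<open>In reachable states every agent occurs at most once in the queues, so the descriptions
  in \<open>pos\<close> and \<open>lane_of\<close> are well defined there.\<close>

definition queued_at :: "env_state \<Rightarrow> agent \<Rightarrow> lane \<Rightarrow> nat \<Rightarrow> bool" where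
  "queued_at s i l p \<longleftrightarrow> p < length (queue s l) \<and> queue s l ! p = i"

definition queued :: "env_state \<Rightarrow> agent \<Rightarrow> bool" where
  "queued s i \<longleftrightarrow> (\<exists>l p. queued_at s i l p)"

definition pos :: "env_state \<Rightarrow> agent \<Rightarrow> nat ext" where
  "pos s i = (if queued s i then Val (THE p. \<exists>l. queued_at s i l p)
     else if i \<in> departed s then Top else Bot)"

definition front :: "env_state \<Rightarrow> agent \<Rightarrow> bool" where
  "front s i \<longleftrightarrow> pos s i = Val 0"

definition lane_of :: "env_state \<Rightarrow> agent \<Rightarrow> lane ext" where
  "lane_of s i = (if queued s i then Val (THE l. \<exists>p. queued_at s i l p)
     else if i \<in> departed s then Top else Bot)"

definition intent :: "env_state \<Rightarrow> agent \<Rightarrow> lane" where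
  "intent s i = snd (snd (arrival (adv s) i))"

definition sensor :: "('u, 'x, 'g) int_context \<Rightarrow> agent \<Rightarrow> env_state \<Rightarrow> 'x reading" where
  "sensor \<gamma> i s =
     \<lparr>front_s = front s i, lane_s = lane_of s i, intent_s = intent s i, extra_s = extra \<gamma> i s\<rparr>"

definition local_states :: "('u, 'x, 'g) int_context \<Rightarrow> agent \<Rightarrow> ('u, 'x) local_state set" where
  "local_states \<gamma> i = mem \<gamma> i \<times> readings \<gamma> i"

definition intersection_context :: "('u, 'x, 'g) int_context \<Rightarrow> bool" where
  "intersection_context \<gamma> \<longleftrightarrow>
     1 < n_in \<gamma> \<and> n_in \<gamma> < n_lanes \<gamma> \<and>
     compat \<gamma> \<subseteq> moves \<gamma> \<times> moves \<gamma> \<and> sym (compat \<gamma>) \<and>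
     (\<forall>\<alpha>\<in>model \<gamma>. is_adversary \<gamma> \<alpha>) \<and>
     (\<forall>i\<in>agents \<gamma>.
        init_mem \<gamma> i \<subseteq> mem \<gamma> i \<and>
        (\<forall>s\<in>env_states \<gamma>. sensor \<gamma> i s \<in> readings \<gamma> i) \<and>
        (\<forall>s\<in>local_states \<gamma> i. \<forall>a. \<forall>x\<in>readings \<gamma> i. mu \<gamma> i s a x \<in> insert None (Some ` msgs \<gamma> i)) \<and>
        (\<forall>s\<in>local_states \<gamma> i. \<forall>a B. B \<subseteq> (\<Union>j\<in>agents \<gamma>. msgs \<gamma> j) \<longrightarrow> delta \<gamma> i s a B \<in> mem \<gamma> i))"

definition protocol :: "('u, 'x, 'g) int_context \<Rightarrow> ('u, 'x) protocol \<Rightarrow> bool" where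
  "protocol \<gamma> P \<longleftrightarrow> (\<forall>i\<in>agents \<gamma>. \<forall>s\<in>local_states \<gamma> i. P i s = Go \<longrightarrow> front_s (snd s))"


subsection \<open>Runs\<close>

definition initial :: "('u, 'x, 'g) int_context \<Rightarrow> ('u, 'x) global_state \<Rightarrow> bool" where
  "initial \<gamma> g \<longleftrightarrow>
     (\<exists>\<alpha>\<in>model \<gamma>. fst g = \<lparr>adv = \<alpha>, time = 0, queue = (\<lambda>_. []), departed = {}\<rparr>) \<and>
     (\<exists>u. (\<forall>i\<in>agents \<gamma>. u i \<in> init_mem \<gamma> i) \<and>
          snd g = (\<lambda>i\<in>agents \<gamma>. (u i, sensor \<gamma> i (fst g))))"

definition leaving :: "env_state \<Rightarrow> (agent \<Rightarrow> action) \<Rightarrow> lane \<Rightarrow> bool" where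
  "leaving s act l \<longleftrightarrow> queue s l \<noteq> [] \<and> act (hd (queue s l)) = Go"

text \<open>The set of agents arriving in lane \<open>l\<close> at a given time has at most one element.\<close>

definition arrivals :: "('u, 'x, 'g) int_context \<Rightarrow> adversary \<Rightarrow> nat \<Rightarrow> lane \<Rightarrow> agent list" where
  "arrivals \<gamma> \<alpha> t l = sorted_list_of_set {i \<in> agents \<gamma>. \<exists>l'. arrival \<alpha> i = (t, l, l')}"

definition env_step ::
    "('u, 'x, 'g) int_context \<Rightarrow> (agent \<Rightarrow> action) \<Rightarrow> env_state \<Rightarrow> env_state" where
  "env_step \<gamma> act s =
     \<lparr>adv = adv s, time = Suc (time s),
      queue = (\<lambda>l. (if leaving s act l then tl (queue s l) else queue s l)
                   @ arrivals \<gamma> (adv s) (Suc (time s)) l),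
      departed = departed s \<union> {hd (queue s l) | l. leaving s act l}\<rparr>"

text \<open>The messages received by agent \<open>i\<close> in the round leading from \<open>s\<close> to \<open>s'\<close>, where \<open>msg j\<close>
  is what \<open>j\<close> broadcasts.\<close>

definition received ::
    "('u, 'x, 'g) int_context \<Rightarrow> (agent \<Rightarrow> 'g option) \<Rightarrow> env_state \<Rightarrow> env_state \<Rightarrow> agent \<Rightarrow> 'g set" where
  "received \<gamma> msg s s' i =
     (if \<not> queued s' i \<or> \<not> Fr (adv s) (time s) i then {}
      else {b. \<exists>j\<in>agents \<gamma>. msg j = Some b \<and> Ft (adv s) (time s) j \<and>
              (\<exists>l p l' p'. queued_at s' j l p \<and> queued_at s' i l' p' \<and>
                 ((l, p), (l', p')) \<in> transmission (adv s))})"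

definition step ::
    "('u, 'x, 'g) int_context \<Rightarrow> ('u, 'x) protocol \<Rightarrow> ('u, 'x) global_state \<Rightarrow> ('u, 'x) global_state" where
  "step \<gamma> P g =
     (let act = (\<lambda>i. P i (snd g i));
          s' = env_step \<gamma> act (fst g);
          msg = (\<lambda>i. mu \<gamma> i (snd g i) (act i) (sensor \<gamma> i s'))
      in (s', \<lambda>i\<in>agents \<gamma>.
           (delta \<gamma> i (snd g i) (act i) (received \<gamma> msg (fst g) s' i), sensor \<gamma> i s')))"

definition runs :: "('u, 'x, 'g) int_context \<Rightarrow> ('u, 'x) protocol \<Rightarrow> ('u, 'x) run set" where
  "runs \<gamma> P = {r. initial \<gamma> (r 0) \<and> (\<forall>m. r (Suc m) = step \<gamma> P (r m))}"

abbreviation env :: "('u, 'x) run \<Rightarrow> nat \<Rightarrow> env_state" where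
  "env r m \<equiv> fst (r m)"

abbreviation loc :: "('u, 'x) run \<Rightarrow> nat \<Rightarrow> agent \<Rightarrow> ('u, 'x) local_state" where
  "loc r m i \<equiv> snd (r m) i"


subsection \<open>Knowledge, time and validity\<close>

definition knows :: "('u, 'x) run set \<Rightarrow> agent \<Rightarrow> ('u, 'x) formula \<Rightarrow> ('u, 'x) formula" where
  "knows I i \<phi> r m \<longleftrightarrow> (\<forall>r'\<in>I. \<forall>m'. loc r' m' i = loc r m i \<longrightarrow> \<phi> r' m')"

definition next_time :: "('u, 'x) formula \<Rightarrow> ('u, 'x) formula" where
  "next_time \<phi> r m \<longleftrightarrow> \<phi> r (Suc m)"

definition eventually_true :: "('u, 'x) formula \<Rightarrow> ('u, 'x) formula" where
  "eventually_true \<phi> r m \<longleftrightarrow> (\<exists>m'\<ge>m. \<phi> r m')"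

definition valid :: "('u, 'x) run set \<Rightarrow> ('u, 'x) formula \<Rightarrow> bool" where
  "valid I \<phi> \<longleftrightarrow> (\<forall>r\<in>I. \<forall>m. \<phi> r m)"

definition fronting :: "agent \<Rightarrow> ('u, 'x) formula" where
  "fronting i r m \<longleftrightarrow> front (env r m) i"

definition going :: "agent \<Rightarrow> ('u, 'x) formula" where
  "going i r m \<longleftrightarrow> fronting i r m \<and> next_time (\<lambda>r m. \<not> fronting i r m) r m"

definition synchronous :: "('u, 'x, 'g) int_context \<Rightarrow> bool" where
  "synchronous \<gamma> \<longleftrightarrow>
     (\<forall>P. protocol \<gamma> P \<longrightarrow>
        (\<forall>r\<in>runs \<gamma> P. \<forall>r'\<in>runs \<gamma> P. \<forall>m m'. \<forall>i\<in>agents \<gamma>. loc r m i = loc r' m' i \<longrightarrow> m = m'))"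


subsection \<open>Intersection protocols\<close>

definition move_in :: "agent \<Rightarrow> env_state \<Rightarrow> move set \<Rightarrow> bool" where
  "move_in i s M \<longleftrightarrow> (\<exists>l. lane_of s i = Val l \<and> (l, intent s i) \<in> M)"

definition moves_compatible ::
    "('u, 'x, 'g) int_context \<Rightarrow> env_state \<Rightarrow> agent \<Rightarrow> agent \<Rightarrow> bool" where
  "moves_compatible \<gamma> s i j \<longleftrightarrow>
     (\<exists>l l'. lane_of s i = Val l \<and> lane_of s j = Val l' \<and>
        ((l, intent s i), (l', intent s j)) \<in> compat \<gamma>)"

definition validity :: "('u, 'x, 'g) int_context \<Rightarrow> ('u, 'x) protocol \<Rightarrow> bool" where
  "validity \<gamma> P \<longleftrightarrow>
     (\<forall>i\<in>agents \<gamma>. valid (runs \<gamma> P) (\<lambda>r m. going i r m \<longrightarrow> fronting i r m))"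

definition safety :: "('u, 'x, 'g) int_context \<Rightarrow> ('u, 'x) protocol \<Rightarrow> bool" where
  "safety \<gamma> P \<longleftrightarrow>
     (\<forall>i\<in>agents \<gamma>. \<forall>j\<in>agents \<gamma>. i \<noteq> j \<longrightarrow>
        valid (runs \<gamma> P) (\<lambda>r m. going i r m \<and> going j r m \<longrightarrow> moves_compatible \<gamma> (env r m) i j))"

definition liveness :: "('u, 'x, 'g) int_context \<Rightarrow> ('u, 'x) protocol \<Rightarrow> bool" where
  "liveness \<gamma> P \<longleftrightarrow>
     (\<forall>i\<in>agents \<gamma>. valid (runs \<gamma> P) (\<lambda>r m. fronting i r m \<longrightarrow> eventually_true (going i) r m))"

definition intersection_protocol :: "('u, 'x, 'g) int_context \<Rightarrow> ('u, 'x) protocol \<Rightarrow> bool" where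
  "intersection_protocol \<gamma> P \<longleftrightarrow> protocol \<gamma> P \<and> validity \<gamma> P \<and> safety \<gamma> P \<and> liveness \<gamma> P"


subsection \<open>Lexicographic optimality\<close>

definition GO :: "('u, 'x, 'g) int_context \<Rightarrow> ('u, 'x) run \<Rightarrow> nat \<Rightarrow> agent set" where
  "GO \<gamma> r m = {i \<in> agents \<gamma>. going i r m}"

definition lex_dominates ::
    "('u, 'x, 'g) int_context \<Rightarrow> ('u, 'x) protocol \<Rightarrow> ('u, 'x) protocol \<Rightarrow> bool" where
  "lex_dominates \<gamma> P P' \<longleftrightarrow>
     (\<forall>r\<in>runs \<gamma> P. \<forall>r'\<in>runs \<gamma> P'. r 0 = r' 0 \<longrightarrow>
        (\<forall>m. GO \<gamma> r m = GO \<gamma> r' m) \<or>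
        (\<exists>m. (\<forall>n<m. GO \<gamma> r n = GO \<gamma> r' n) \<and> GO \<gamma> r' m \<subset> GO \<gamma> r m))"

definition strictly_lex_dominates ::
    "('u, 'x, 'g) int_context \<Rightarrow> ('u, 'x) protocol \<Rightarrow> ('u, 'x) protocol \<Rightarrow> bool" where
  "strictly_lex_dominates \<gamma> P P' \<longleftrightarrow> lex_dominates \<gamma> P P' \<and> \<not> lex_dominates \<gamma> P' P"

definition lex_optimal :: "('u, 'x, 'g) int_context \<Rightarrow> ('u, 'x) protocol \<Rightarrow> bool" where
  "lex_optimal \<gamma> P \<longleftrightarrow>
     \<not> (\<exists>P'. intersection_protocol \<gamma> P' \<and> strictly_lex_dominates \<gamma> P' P)"


subsection \<open>Policies\<close>

type_synonym slice =
  "(agent \<times> lane \<times> lane) set \<times> ((lane \<times> nat) \<times> (lane \<times> nat)) set \<times> (agent \<Rightarrow> bool) \<times> (agent \<Rightarrow> bool)"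

type_synonym policy = "slice list \<Rightarrow> move set"

definition slice :: "('u, 'x, 'g) int_context \<Rightarrow> adversary \<Rightarrow> nat \<Rightarrow> slice" where
  "slice \<gamma> \<alpha> m =
     ({(i, l, l'). i \<in> agents \<gamma> \<and> arrival \<alpha> i = (Suc m, l, l')}, transmission \<alpha>, Fr \<alpha> m, Ft \<alpha> m)"

definition history :: "('u, 'x, 'g) int_context \<Rightarrow> adversary \<Rightarrow> nat \<Rightarrow> slice list" where
  "history \<gamma> \<alpha> m = map (slice \<gamma> \<alpha>) [0..<m]"

definition run_history :: "('u, 'x, 'g) int_context \<Rightarrow> ('u, 'x) run \<Rightarrow> nat \<Rightarrow> slice list" where
  "run_history \<gamma> r m = history \<gamma> (adv (env r 0)) m"

definition histories :: "('u, 'x, 'g) int_context \<Rightarrow> slice list set" where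
  "histories \<gamma> = {history \<gamma> \<alpha> m | \<alpha> m. \<alpha> \<in> model \<gamma>}"

definition intersection_policy :: "('u, 'x, 'g) int_context \<Rightarrow> policy \<Rightarrow> bool" where
  "intersection_policy \<gamma> \<sigma> \<longleftrightarrow> (\<forall>h\<in>histories \<gamma>. \<sigma> h \<subseteq> moves \<gamma>)"

definition conflict_free :: "('u, 'x, 'g) int_context \<Rightarrow> policy \<Rightarrow> bool" where
  "conflict_free \<gamma> \<sigma> \<longleftrightarrow>
     (\<forall>h\<in>histories \<gamma>. \<forall>a\<in>\<sigma> h. \<forall>b\<in>\<sigma> h. a \<noteq> b \<longrightarrow> (a, b) \<in> compat \<gamma>)"

definition fair :: "('u, 'x, 'g) int_context \<Rightarrow> policy \<Rightarrow> bool" where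
  "fair \<gamma> \<sigma> \<longleftrightarrow> (\<forall>\<alpha>\<in>model \<gamma>. \<forall>a\<in>moves \<gamma>. \<forall>m. \<exists>m'\<ge>m. a \<in> \<sigma> (history \<gamma> \<alpha> m'))"

definition policy_aware :: "('u, 'x, 'g) int_context \<Rightarrow> policy \<Rightarrow> bool" where
  "policy_aware \<gamma> \<sigma> \<longleftrightarrow>
     (\<forall>P. protocol \<gamma> P \<longrightarrow>
        (\<forall>i\<in>agents \<gamma>. \<forall>l\<in>lanes_in \<gamma>. \<forall>l'\<in>lanes_out \<gamma>.
           valid (runs \<gamma> P) (\<lambda>r m.
             (l, l') \<in> \<sigma> (run_history \<gamma> r m) \<and> lane_of (env r m) i = Val l \<longrightarrow>
             knows (runs \<gamma> P) i (\<lambda>r m. (l, l') \<in> \<sigma> (run_history \<gamma> r m)) r m)))"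

definition next_aware :: "('u, 'x, 'g) int_context \<Rightarrow> (slice list \<Rightarrow> lane) \<Rightarrow> bool" where
  "next_aware \<gamma> nxt \<longleftrightarrow>
     (\<forall>P. protocol \<gamma> P \<longrightarrow>
        (\<forall>i\<in>agents \<gamma>. \<forall>l\<in>lanes_in \<gamma>.
           valid (runs \<gamma> P) (\<lambda>r m.
             nxt (run_history \<gamma> r m) = l \<longrightarrow>
             knows (runs \<gamma> P) i (\<lambda>r m. nxt (run_history \<gamma> r m) = l) r m)))"


subsection \<open>Knowledge-based programs\<close>

text \<open>A program ``if \<open>K\<^sub>i \<phi>\<^sub>i\<close> then go else noop'' is represented by the family \<open>\<phi>\<close> of its tests.\<close>

type_synonym ('u, 'x) kb_program = "agent \<Rightarrow> ('u, 'x) formula"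

definition implements ::
    "('u, 'x, 'g) int_context \<Rightarrow> ('u, 'x) kb_program \<Rightarrow> ('u, 'x) protocol \<Rightarrow> bool" where
  "implements \<gamma> \<phi> P \<longleftrightarrow> protocol \<gamma> P \<and>
     (\<forall>r\<in>runs \<gamma> P. \<forall>m. \<forall>i\<in>agents \<gamma>. P i (loc r m i) = Go \<longleftrightarrow> knows (runs \<gamma> P) i (\<phi> i) r m)"

definition agree_on_reachable ::
    "('u, 'x, 'g) int_context \<Rightarrow> ('u, 'x) protocol \<Rightarrow> ('u, 'x) protocol \<Rightarrow> bool" where
  "agree_on_reachable \<gamma> P P' \<longleftrightarrow>
     (\<forall>r\<in>runs \<gamma> P \<union> runs \<gamma> P'. \<forall>m. \<forall>i\<in>agents \<gamma>. P i (loc r m i) = P' i (loc r m i))"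

definition unique_implementation_exists ::
    "('u, 'x, 'g) int_context \<Rightarrow> ('u, 'x) kb_program \<Rightarrow> bool" where
  "unique_implementation_exists \<gamma> \<phi> \<longleftrightarrow>
     (\<exists>P. implements \<gamma> \<phi> P) \<and>
     (\<forall>P P'. implements \<gamma> \<phi> P \<and> implements \<gamma> \<phi> P' \<longrightarrow> agree_on_reachable \<gamma> P P')"

text \<open>The lanes \<open>a, a + 1, \<dots>, b - 1\<close> modulo \<open>n\<close>, for \<open>a, b < n\<close>; empty if \<open>a = b\<close>.\<close>

definition cyclic_interval :: "nat \<Rightarrow> lane \<Rightarrow> lane \<Rightarrow> lane set" where
  "cyclic_interval n a b = {(a + d) mod n | d. d < (b + n - a) mod n}"

definition lane_between ::
    "('u, 'x, 'g) int_context \<Rightarrow> env_state \<Rightarrow> lane \<Rightarrow> agent \<Rightarrow> agent \<Rightarrow> bool" where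
  "lane_between \<gamma> s a j i \<longleftrightarrow>
     (\<exists>l l'. lane_of s j = Val l \<and> lane_of s i = Val l' \<and> l \<in> cyclic_interval (n_in \<gamma>) a l')"

definition V ::
    "('u, 'x, 'g) int_context \<Rightarrow> policy \<Rightarrow> (slice list \<Rightarrow> lane) \<Rightarrow> agent \<Rightarrow> ('u, 'x) formula" where
  "V \<gamma> \<sigma> nxt i r m \<longleftrightarrow>
     \<not> move_in i (env r m) (\<sigma> (run_history \<gamma> r m)) \<and>
     (\<forall>j\<in>agents \<gamma>. going j r m \<and> move_in j (env r m) (\<sigma> (run_history \<gamma> r m)) \<longrightarrow>
        moves_compatible \<gamma> (env r m) i j) \<and>
     (\<forall>j\<in>agents \<gamma>. j \<noteq> i \<and> going j r m \<and> \<not> move_in j (env r m) (\<sigma> (run_history \<gamma> r m)) \<and>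
        lane_between \<gamma> (env r m) (nxt (run_history \<gamma> r m)) j i \<longrightarrow>
        moves_compatible \<gamma> (env r m) i j)"

definition kbp_policy :: "('u, 'x, 'g) int_context \<Rightarrow> policy \<Rightarrow> ('u, 'x) kb_program" where
  "kbp_policy \<gamma> \<sigma> i r m \<longleftrightarrow>
     fronting i r m \<and> move_in i (env r m) (\<sigma> (run_history \<gamma> r m))"

definition kbp_optimal ::
    "('u, 'x, 'g) int_context \<Rightarrow> policy \<Rightarrow> (slice list \<Rightarrow> lane) \<Rightarrow> ('u, 'x) kb_program" where
  "kbp_optimal \<gamma> \<sigma> nxt i r m \<longleftrightarrow>
     fronting i r m \<and> (move_in i (env r m) (\<sigma> (run_history \<gamma> r m)) \<or> V \<gamma> \<sigma> nxt i r m)"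

end

theory Submission
  imports Defs
begin

text \<open>Points are ranked lexicographically by time and by the cyclic distance of the agent's lane from
  \<open>next\<close>, with agents moving by the policy first.  Synchrony and awareness make the rank of a point
  known to the agent, and the test of the program at a point depends only on actions at smaller
  ranks; hence implementations exist and are unique.  Any two agents that go
  are compatible because the later one in the cyclic order has tested against the earlier one.
  A safe protocol cannot add a go at the first difference: the added agent considers it possible
  that an incompatible agent goes.\<close>

text \<open>The test of the program is evaluated in the system generated by the very protocol that
  it is to define, and \<open>V\<close> mentions \<open>going\<close>, that is, actions of the round
  in which the agent is still deciding. The lanes supply the missing parameter, since at most one
  agent per lane can go in a round. The recursion is sound only because an agent assigns the same
  measure to all points that it cannot tell apart; this is where awareness of \<open>next\<close>
  and of \<open>\<sigma>\<close> enters. Existence and uniqueness are shown for any program whose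
  tests respect the measure, so both programs are instances. For optimality, all initial states are
  treated at once in an induction on time, because the conflict that holds an agent back may lie in
  another run than the one considered.\<close>

lemma action_eqI: "(a = Go \<longleftrightarrow> b = Go) \<Longrightarrow> a = b"
  by (cases a; cases b) simp_all

section \<open>Runs as iterated steps from an initial state\<close>

definition trajectory ::
    "('u, 'x, 'g) int_context \<Rightarrow> ('u, 'x) protocol \<Rightarrow> ('u, 'x) global_state \<Rightarrow> ('u, 'x) run" where
  "trajectory \<gamma> P g m = (step \<gamma> P ^^ m) g"

lemma trajectory_0 [simp]: "trajectory \<gamma> P g 0 = g"
  by (simp add: trajectory_def)

lemma trajectory_Suc: "trajectory \<gamma> P g (Suc m) = step \<gamma> P (trajectory \<gamma> P g m)"
  by (simp add: trajectory_def)

lemma trajectory_in_runs: "initial \<gamma> g \<Longrightarrow> trajectory \<gamma> P g \<in> runs \<gamma> P"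
  by (simp add: runs_def trajectory_Suc)

text \<open>A step is deterministic, so corresponding runs of two protocols are the trajectories of
  one and the same initial state \<open>g\<close>; from here on points are given by \<open>g\<close>
  and a time.\<close>

lemma runs_trajectory:
  assumes "r \<in> runs \<gamma> P"
  shows "initial \<gamma> (r 0)" "r = trajectory \<gamma> P (r 0)"
proof -
  show "initial \<gamma> (r 0)" using assms by (simp add: runs_def)
  have "r m = trajectory \<gamma> P (r 0) m" for m
    using assms by (induction m) (simp_all add: runs_def trajectory_Suc)
  then show "r = trajectory \<gamma> P (r 0)" by blast
qed

section \<open>Well-formed environment states\<close>

definition well_formed :: "('u, 'x, 'g) int_context \<Rightarrow> env_state \<Rightarrow> bool" where
  "well_formed \<gamma> s \<longleftrightarrow> adv s \<in> model \<gamma> \<and> departed s \<subseteq> agents \<gamma> \<and>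
     (\<forall>l. distinct (queue s l) \<and>
       (\<forall>i\<in>set (queue s l). i \<in> agents \<gamma> \<and> fst (arrival (adv s) i) \<le> time s \<and>
          fst (snd (arrival (adv s) i)) = l))"

lemma well_formed_queue:
  assumes "well_formed \<gamma> s"
  shows "distinct (queue s l)"
    and "i \<in> set (queue s l) \<Longrightarrow> i \<in> agents \<gamma>"
    and "i \<in> set (queue s l) \<Longrightarrow> fst (arrival (adv s) i) \<le> time s"
    and "i \<in> set (queue s l) \<Longrightarrow> fst (snd (arrival (adv s) i)) = l"
  using assms by (auto simp: well_formed_def)

lemma queued_at_unique:
  assumes "well_formed \<gamma> s" "queued_at s i l p" "queued_at s i l' p'"
  shows "l = l' \<and> p = p'"
proof -
  have "i \<in> set (queue s l)" "i \<in> set (queue s l')"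
    using assms(2,3) unfolding queued_at_def by (metis nth_mem)+
  then have l: "l = l'" using well_formed_queue(4)[OF assms(1)] by metis
  then show ?thesis
    using assms(2,3) well_formed_queue(1)[OF assms(1), of l]
    by (auto simp: queued_at_def nth_eq_iff_index_eq)
qed

lemma pos_lane_queued_at:
  assumes "well_formed \<gamma> s" "queued_at s i l p"
  shows "pos s i = Val p" "lane_of s i = Val l"
proof -
  have q: "queued s i" using assms(2) by (auto simp: queued_def)
  have "(THE p. \<exists>l. queued_at s i l p) = p" "(THE l. \<exists>p. queued_at s i l p) = l"
    using assms(2) queued_at_unique[OF assms] by (blast intro: the_equality)+
  then show "pos s i = Val p" "lane_of s i = Val l"
    using q by (simp_all add: pos_def lane_of_def)
qed

lemma lane_of_iff:
  assumes "well_formed \<gamma> s"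
  shows "lane_of s i = Val l \<longleftrightarrow> i \<in> set (queue s l)"
proof
  assume L: "lane_of s i = Val l"
  then have "queued s i" by (auto simp: lane_of_def split: if_splits)
  then obtain l' p where q: "queued_at s i l' p" by (auto simp: queued_def)
  then have "l' = l" using pos_lane_queued_at(2)[OF assms q] L by simp
  then show "i \<in> set (queue s l)" using q by (auto simp: queued_at_def)
next
  assume "i \<in> set (queue s l)"
  then obtain p where "queued_at s i l p" by (auto simp: queued_at_def in_set_conv_nth)
  then show "lane_of s i = Val l" using pos_lane_queued_at(2)[OF assms] by blast
qed

lemma front_iff:
  assumes "well_formed \<gamma> s"
  shows "front s i \<longleftrightarrow> (\<exists>l. queue s l \<noteq> [] \<and> hd (queue s l) = i)"
proof
  assume F: "front s i"
  then have "queued s i" by (auto simp: front_def pos_def split: if_splits)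
  then obtain l p where q: "queued_at s i l p" by (auto simp: queued_def)
  then have "p = 0" using pos_lane_queued_at(1)[OF assms q] F by (simp add: front_def)
  then show "\<exists>l. queue s l \<noteq> [] \<and> hd (queue s l) = i"
    using q by (auto simp: queued_at_def hd_conv_nth)
next
  assume "\<exists>l. queue s l \<noteq> [] \<and> hd (queue s l) = i"
  then obtain l where "queued_at s i l 0" by (auto simp: queued_at_def hd_conv_nth)
  then show "front s i" using pos_lane_queued_at(1)[OF assms] by (simp add: front_def)
qed

lemma front_lane:
  assumes "well_formed \<gamma> s" "front s i"
  obtains l where "lane_of s i = Val l" "queue s l \<noteq> []" "hd (queue s l) = i" "i \<in> agents \<gamma>"
proof -
  obtain l where l: "queue s l \<noteq> []" "hd (queue s l) = i"
    using assms front_iff[OF assms(1)] by blast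
  then have "i \<in> set (queue s l)" by auto
  then show thesis using that l lane_of_iff[OF assms(1)] well_formed_queue(2)[OF assms(1)] by blast
qed

lemma fronts_distinct_lanes:
  assumes "well_formed \<gamma> s" "front s i" "front s j" "i \<noteq> j" "lane_of s i = Val l" "lane_of s j = Val l'"
  shows "l \<noteq> l'"
  using assms by (metis ext.inject(1) front_lane)

lemma set_arrivals:
  "set (arrivals \<gamma> \<alpha> t l) \<subseteq> {i \<in> agents \<gamma>. fst (arrival \<alpha> i) = t \<and> fst (snd (arrival \<alpha> i)) = l}"
proof (cases "finite {i \<in> agents \<gamma>. \<exists>l'. arrival \<alpha> i = (t, l, l')}")
  case True
  then show ?thesis by (auto simp: arrivals_def)
next
  case False
  then show ?thesis unfolding arrivals_def
    \<comment> \<open>\<open>sorted_list_of_set\<close> of an infinite set is the empty list, so the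
      inclusion is trivial here.\<close>
    by (subst sorted_list_of_set.fold_insort_key.infinite) auto
qed

lemma env_step_simps [simp]:
  "adv (env_step \<gamma> act s) = adv s"
  "time (env_step \<gamma> act s) = Suc (time s)"
  "queue (env_step \<gamma> act s) l = (if leaving s act l then tl (queue s l) else queue s l)
     @ arrivals \<gamma> (adv s) (Suc (time s)) l"
  "departed (env_step \<gamma> act s) = departed s \<union> {hd (queue s l) | l. leaving s act l}"
  by (simp_all add: env_step_def)

text \<open>The clause on arrival times in \<open>well_formed\<close> keeps the queues free of
  repetitions: an agent joining at \<open>Suc (time s)\<close> cannot be waiting already. The clause
  on lanes confines each agent to one queue.\<close>

lemma well_formed_env_step:
  assumes wf: "well_formed \<gamma> s"
  shows "well_formed \<gamma> (env_step \<gamma> act s)"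
proof -
  let ?q = "\<lambda>l. if leaving s act l then tl (queue s l) else queue s l"
  have sub: "set (?q l) \<subseteq> set (queue s l)" for l
    by (cases "queue s l") auto
  have dist: "distinct (?q l)" for l
    using well_formed_queue(1)[OF wf, of l] by (simp add: distinct_tl)
  have disj: "set (?q l) \<inter> set (arrivals \<gamma> (adv s) (Suc (time s)) l) = {}" for l
    using sub[of l] set_arrivals[of \<gamma> "adv s" "Suc (time s)" l] well_formed_queue(3)[OF wf, of _ l]
    by fastforce
  have "distinct (?q l @ arrivals \<gamma> (adv s) (Suc (time s)) l)" for l
    using dist disj by (simp add: arrivals_def)
  moreover have "i \<in> agents \<gamma> \<and> fst (arrival (adv s) i) \<le> Suc (time s) \<and>
      fst (snd (arrival (adv s) i)) = l"
    if "i \<in> set (?q l @ arrivals \<gamma> (adv s) (Suc (time s)) l)" for i l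
  proof -
    have "i \<in> set (queue s l) \<or> i \<in> set (arrivals \<gamma> (adv s) (Suc (time s)) l)"
      using that sub[of l] by auto
    then show ?thesis
      using set_arrivals[of \<gamma> "adv s" "Suc (time s)" l] well_formed_queue(2,3,4)[OF wf, of i l]
      by fastforce
  qed
  moreover have "{hd (queue s l) | l. leaving s act l} \<subseteq> agents \<gamma>"
    using well_formed_queue(2)[OF wf] hd_in_set by (fastforce simp: leaving_def)
  ultimately show ?thesis
    using wf unfolding well_formed_def env_step_simps by blast
qed

lemma well_formed_initial: "initial \<gamma> g \<Longrightarrow> well_formed \<gamma> (fst g)"
  by (auto simp: initial_def well_formed_def)

lemma fst_step: "fst (step \<gamma> P g) = env_step \<gamma> (\<lambda>i. P i (snd g i)) (fst g)"
  by (simp add: step_def Let_def)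

lemma well_formed_trajectory:
  assumes "initial \<gamma> g"
  shows "well_formed \<gamma> (env (trajectory \<gamma> P g) m)"
  using well_formed_initial[OF assms]
  by (induction m) (simp_all add: trajectory_Suc fst_step well_formed_env_step)

lemma adv_trajectory: "adv (env (trajectory \<gamma> P g) m) = adv (fst g)"
  by (induction m) (simp_all add: trajectory_Suc fst_step)

lemma sensor_trajectory:
  assumes "initial \<gamma> g" "i \<in> agents \<gamma>"
  shows "snd (loc (trajectory \<gamma> P g) m i) = sensor \<gamma> i (env (trajectory \<gamma> P g) m)"
proof (cases m)
  case 0
  then show ?thesis using assms by (auto simp: initial_def)
next
  case (Suc n)
  then show ?thesis using assms by (simp add: trajectory_Suc step_def Let_def)
qed

text \<open>The heads of well-formed queues are agents and only agents send messages, so values of a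
  protocol outside \<open>agents \<gamma>\<close> never influence a step.\<close>

lemma step_cong:
  assumes wf: "well_formed \<gamma> (fst g)"
    and act: "\<And>i. i \<in> agents \<gamma> \<Longrightarrow> P i (snd g i) = Q i (snd g i)"
  shows "step \<gamma> P g = step \<gamma> Q g"
proof -
  have "leaving (fst g) (\<lambda>i. P i (snd g i)) l = leaving (fst g) (\<lambda>i. Q i (snd g i)) l" for l
    using act well_formed_queue(2)[OF wf, of _ l] by (auto simp: leaving_def)
  then have e: "env_step \<gamma> (\<lambda>i. P i (snd g i)) (fst g) = env_step \<gamma> (\<lambda>i. Q i (snd g i)) (fst g)"
    by (simp add: env_step_def)
  have "received \<gamma> (\<lambda>i. mu \<gamma> i (snd g i) (P i (snd g i)) (sensor \<gamma> i s')) (fst g) s' =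
      received \<gamma> (\<lambda>i. mu \<gamma> i (snd g i) (Q i (snd g i)) (sensor \<gamma> i s')) (fst g) s'" for s'
    using act unfolding received_def by (intro ext if_cong refl) auto
  then show ?thesis
    using act by (simp add: step_def Let_def e restrict_def fun_eq_iff)
qed

text \<open>Replaces the temporal \<open>going\<close> by an action of the current round. A head
  that performs \<open>Go\<close> cannot be at a front again: distinctness keeps it out of the tail,
  its arrival time out of the newcomers, its arrival lane out of the other queues.\<close>

lemma going_trajectory:
  assumes "initial \<gamma> g"
  shows "going i (trajectory \<gamma> P g) m \<longleftrightarrow>
    front (env (trajectory \<gamma> P g) m) i \<and> P i (loc (trajectory \<gamma> P g) m i) = Go"
proof -
  define x where "x = trajectory \<gamma> P g m"
  define act where "act = (\<lambda>i. P i (snd x i))"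
  have wf: "well_formed \<gamma> (fst x)" using well_formed_trajectory[OF assms] by (simp add: x_def)
  have wf': "well_formed \<gamma> (env_step \<gamma> act (fst x))" by (rule well_formed_env_step[OF wf])
  have "front (env_step \<gamma> act (fst x)) i \<longleftrightarrow> act i \<noteq> Go" if F: "front (fst x) i"
  proof -
    obtain l where l: "queue (fst x) l \<noteq> []" "hd (queue (fst x) l) = i"
      using front_lane[OF wf F] by metis
    have iq: "i \<in> set (queue (fst x) l)" using l by auto
    show ?thesis
    proof (cases "act i = Go")
      case True
      have "i \<notin> set (queue (env_step \<gamma> act (fst x)) l')" for l'
      proof
        assume "i \<in> set (queue (env_step \<gamma> act (fst x)) l')"
        moreover have "l' = l"
          using well_formed_queue(4)[OF wf iq] well_formed_queue(4)[OF wf' calculation] by simp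
        ultimately have "i \<in> set (tl (queue (fst x) l)) \<or>
            i \<in> set (arrivals \<gamma> (adv (fst x)) (Suc (time (fst x))) l)"
          using l True by (simp add: leaving_def)
        moreover have "i \<notin> set (tl (queue (fst x) l))"
          using l well_formed_queue(1)[OF wf, of l] by (cases "queue (fst x) l") auto
        ultimately show False
          using set_arrivals[of \<gamma> "adv (fst x)" "Suc (time (fst x))" l]
            well_formed_queue(3)[OF wf iq] by fastforce
      qed
      then show ?thesis using True front_iff[OF wf'] list.set_sel(1) by metis
    next
      case False
      then have "queue (env_step \<gamma> act (fst x)) l \<noteq> [] \<and> hd (queue (env_step \<gamma> act (fst x)) l) = i"
        using l by (simp add: leaving_def)
      then show ?thesis using False front_iff[OF wf'] by blast
    qed
  qed
  then show ?thesis
    by (auto simp: going_def next_time_def fronting_def trajectory_Suc fst_step act_def x_def)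
qed

section \<open>Local states and actions along trajectories\<close>

locale crossing =
  fixes \<gamma> :: "('u, 'x, 'g) int_context"
  assumes is_context: "intersection_context \<gamma>"
begin

abbreviation traj :: "('u, 'x) protocol \<Rightarrow> ('u, 'x) global_state \<Rightarrow> ('u, 'x) run" where
  "traj \<equiv> trajectory \<gamma>"

lemma adversary: "\<alpha> \<in> model \<gamma> \<Longrightarrow> is_adversary \<gamma> \<alpha>"
  using is_context by (simp add: intersection_context_def)

lemma arrival_range:
  assumes "\<alpha> \<in> model \<gamma>" "i \<in> agents \<gamma>"
  shows "fst (snd (arrival \<alpha> i)) \<in> lanes_in \<gamma>" "snd (snd (arrival \<alpha> i)) \<in> lanes_out \<gamma>"
proof -
  have "arrival \<alpha> i \<in> UNIV \<times> lanes_in \<gamma> \<times> lanes_out \<gamma>"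
    using adversary[OF assms(1)] assms(2) unfolding is_adversary_def by (blast dest: PiE_mem)
  then show "fst (snd (arrival \<alpha> i)) \<in> lanes_in \<gamma>" "snd (snd (arrival \<alpha> i)) \<in> lanes_out \<gamma>"
    by auto
qed

lemma lane_in:
  assumes "well_formed \<gamma> s" "lane_of s i = Val l"
  shows "l \<in> lanes_in \<gamma>" "intent s i \<in> lanes_out \<gamma>"
proof -
  have q: "i \<in> set (queue s l)" using assms lane_of_iff by blast
  have "i \<in> agents \<gamma>" "adv s \<in> model \<gamma>"
    using well_formed_queue(2)[OF assms(1) q] assms(1) by (auto simp: well_formed_def)
  then show "l \<in> lanes_in \<gamma>" "intent s i \<in> lanes_out \<gamma>"
    using arrival_range well_formed_queue(4)[OF assms(1) q] by (auto simp: intent_def)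
qed

lemma well_formed_env_states:
  assumes wf: "well_formed \<gamma> s"
  shows "s \<in> env_states \<gamma>"
proof -
  have "queue s l = []" if "l \<notin> lanes_in \<gamma>" for l
  proof (rule ccontr)
    assume "queue s l \<noteq> []"
    then have "lane_of s (hd (queue s l)) = Val l" using lane_of_iff[OF wf] by auto
    then show False using lane_in(1)[OF wf] that by blast
  qed
  then show ?thesis
    using wf well_formed_queue(2)[OF wf] by (auto simp: env_states_def well_formed_def)
qed

lemma sensor_readings: "well_formed \<gamma> s \<Longrightarrow> i \<in> agents \<gamma> \<Longrightarrow> sensor \<gamma> i s \<in> readings \<gamma> i"
  using is_context well_formed_env_states by (simp add: intersection_context_def)

lemma local_states_step:
  assumes wf: "well_formed \<gamma> (fst g)"
    and ls: "\<And>i. i \<in> agents \<gamma> \<Longrightarrow> snd g i \<in> local_states \<gamma> i"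
    and i: "i \<in> agents \<gamma>"
  shows "snd (step \<gamma> P g) i \<in> local_states \<gamma> i"
proof -
  define s' where "s' = env_step \<gamma> (\<lambda>i. P i (snd g i)) (fst g)"
  define msg where "msg = (\<lambda>i. mu \<gamma> i (snd g i) (P i (snd g i)) (sensor \<gamma> i s'))"
  have wf': "well_formed \<gamma> s'" unfolding s'_def by (rule well_formed_env_step[OF wf])
  have "b \<in> msgs \<gamma> j" if "j \<in> agents \<gamma>" "msg j = Some b" for j b
  proof -
    have "msg j \<in> insert None (Some ` msgs \<gamma> j)"
      using is_context that(1) ls[OF that(1)] sensor_readings[OF wf' that(1)]
      unfolding msg_def intersection_context_def by blast
    then show ?thesis using that(2) by auto
  qed
  then have "received \<gamma> msg (fst g) s' i \<subseteq> (\<Union>j\<in>agents \<gamma>. msgs \<gamma> j)"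
    unfolding received_def by (simp split: if_splits) blast
  then have "delta \<gamma> i (snd g i) (P i (snd g i)) (received \<gamma> msg (fst g) s' i) \<in> mem \<gamma> i"
    using is_context i ls[OF i] unfolding intersection_context_def by blast
  then show ?thesis
    using i sensor_readings[OF wf' i] by (simp add: step_def Let_def local_states_def s'_def msg_def)
qed

text \<open>\<open>protocol\<close> ties \<open>Go\<close> to the front only on
  \<open>local_states\<close>, so trajectories must be shown to stay there.\<close>

lemma local_states_trajectory:
  assumes "initial \<gamma> g" "i \<in> agents \<gamma>"
  shows "loc (traj P g) m i \<in> local_states \<gamma> i"
  using assms(2)
proof (induction m arbitrary: i)
  case 0
  have "snd (snd g i) = sensor \<gamma> i (fst g)"
    using sensor_trajectory[OF assms(1) 0, of undefined 0] unfolding trajectory_0 .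
  then have "snd (snd g i) \<in> readings \<gamma> i"
    using sensor_readings[OF well_formed_initial[OF assms(1)] 0] by metis
  moreover obtain u where u: "\<forall>i\<in>agents \<gamma>. u i \<in> init_mem \<gamma> i"
    "snd g = (\<lambda>i\<in>agents \<gamma>. (u i, sensor \<gamma> i (fst g)))"
    using assms(1) unfolding initial_def by blast
  have "fst (snd g i) \<in> init_mem \<gamma> i" unfolding u(2) using u(1) 0 by simp
  then have "fst (snd g i) \<in> mem \<gamma> i"
    using is_context 0 unfolding intersection_context_def by blast
  ultimately show ?case by (simp add: local_states_def mem_Times_iff)
next
  case (Suc m)
  show ?case
    unfolding trajectory_Suc
    by (rule local_states_step[OF well_formed_trajectory[OF assms(1)] Suc.IH Suc.prems])
qed

lemma Go_front:
  assumes "protocol \<gamma> P" "initial \<gamma> g" "i \<in> agents \<gamma>" "P i (loc (traj Q g) m i) = Go"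
  shows "front (env (traj Q g) m) i"
proof -
  have "front_s (snd (loc (traj Q g) m i))"
    using assms local_states_trajectory[OF assms(2,3)] by (auto simp: protocol_def)
  then show ?thesis by (simp only: sensor_trajectory[OF assms(2,3)]) (simp add: sensor_def)
qed

lemma GO_trajectory:
  assumes "protocol \<gamma> P" "initial \<gamma> g"
  shows "GO \<gamma> (traj P g) m = {i \<in> agents \<gamma>. P i (loc (traj P g) m i) = Go}"
  using Go_front[OF assms] going_trajectory[OF assms(2)] by (auto simp: GO_def)

lemma trajectory_Suc_cong:
  assumes "initial \<gamma> g" "traj P g m = traj Q g m"
    and "\<And>i. i \<in> agents \<gamma> \<Longrightarrow> P i (loc (traj P g) m i) = Q i (loc (traj Q g) m i)"
  shows "traj P g (Suc m) = traj Q g (Suc m)"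
  unfolding trajectory_Suc using assms step_cong[OF well_formed_trajectory[OF assms(1)]]
  by metis

text \<open>The sets \<open>GO\<close> determine the actions of all agents. Hence two corresponding
  runs are still in the same global state at their first difference in \<open>GO\<close>.\<close>

lemma trajectory_eq_if_GO_eq:
  assumes "protocol \<gamma> P" "protocol \<gamma> Q" "initial \<gamma> g"
    and "\<And>k. k < m \<Longrightarrow> GO \<gamma> (traj P g) k = GO \<gamma> (traj Q g) k"
  shows "traj P g m = traj Q g m"
  using assms(4)
proof (induction m)
  case (Suc m)
  then have "traj P g m = traj Q g m" by simp
  moreover have "P i (loc (traj P g) m i) = Q i (loc (traj Q g) m i)" if "i \<in> agents \<gamma>" for i
  proof -
    have "i \<in> GO \<gamma> (traj P g) m \<longleftrightarrow> i \<in> GO \<gamma> (traj Q g) m" using Suc.prems[of m] by simp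
    then have "P i (loc (traj P g) m i) = Go \<longleftrightarrow> Q i (loc (traj Q g) m i) = Go"
      using that by (simp add: GO_trajectory[OF assms(1,3)] GO_trajectory[OF assms(2,3)])
    then show ?thesis by (rule action_eqI)
  qed
  ultimately show ?case by (rule trajectory_Suc_cong[OF assms(3)])
qed simp

lemma run_history_trajectory: "run_history \<gamma> (traj P g) m = history \<gamma> (adv (fst g)) m"
  by (simp add: run_history_def)

lemma history_in_histories:
  assumes "initial \<gamma> g"
  shows "history \<gamma> (adv (fst g)) m \<in> histories \<gamma>"
  using assms by (auto simp: initial_def histories_def)

end

section \<open>The cyclic order of the incoming lanes\<close>

definition cyclic_distance :: "nat \<Rightarrow> lane \<Rightarrow> lane \<Rightarrow> nat" where
  "cyclic_distance n a b = (b + n - a) mod n"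

lemma cyclic_distance_eq:
  assumes "a < n" "b < n"
  shows "cyclic_distance n a b = (if a \<le> b then b - a else b + n - a)"
proof (cases "a \<le> b")
  case True
  then have "cyclic_distance n a b = (b - a + n) mod n"
    by (simp add: cyclic_distance_def)
  then show ?thesis using True assms by (simp only: mod_add_self2) simp
qed (use assms in \<open>simp add: cyclic_distance_def\<close>)

text \<open>Turns the interval condition in \<open>V\<close> into a comparison of numbers, which can
  serve as a measure and, by \<open>cyclic_distance_inj\<close>, orders distinct lanes
  totally.\<close>

lemma cyclic_interval_iff:
  assumes "a < n" "l < n"
  shows "l \<in> cyclic_interval n a b \<longleftrightarrow> cyclic_distance n a l < cyclic_distance n a b"
proof
  assume "l \<in> cyclic_interval n a b"
  then obtain d where d: "l = (a + d) mod n" "d < cyclic_distance n a b"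
    unfolding cyclic_interval_def cyclic_distance_def by blast
  have "cyclic_distance n a b < n" using assms by (simp add: cyclic_distance_def)
  then have "d < n" using d(2) by simp
  have "cyclic_distance n a l = d"
  proof (cases "a + d < n")
    case True
    then have "l = a + d" using d(1) by simp
    then show ?thesis using assms by (simp add: cyclic_distance_eq)
  next
    case False
    have "l = (a + d - n) mod n" using False d(1) le_mod_geq[of n "a + d"] by linarith
    then have "l = a + d - n" using \<open>d < n\<close> assms(1) by simp
    then show ?thesis using False \<open>d < n\<close> assms by (simp add: cyclic_distance_eq)
  qed
  then show "cyclic_distance n a l < cyclic_distance n a b" using d(2) by simp
next
  assume "cyclic_distance n a l < cyclic_distance n a b"
  then have "(a + cyclic_distance n a l) mod n \<in> cyclic_interval n a b"
    unfolding cyclic_interval_def cyclic_distance_def by blast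
  moreover have "(a + cyclic_distance n a l) mod n = l"
    using assms by (cases "a \<le> l") (simp_all add: cyclic_distance_eq)
  ultimately show "l \<in> cyclic_interval n a b" by simp
qed

lemma cyclic_distance_inj:
  assumes "a < n" "l < n" "l' < n" "cyclic_distance n a l = cyclic_distance n a l'"
  shows "l = l'"
  using assms(4) assms(1-3) unfolding cyclic_distance_eq[OF assms(1,2)] cyclic_distance_eq[OF assms(1,3)]
  by (cases "a \<le> l"; cases "a \<le> l'") simp_all

section \<open>What synchrony and awareness let an agent know\<close>

locale aware_crossing = crossing \<gamma> for \<gamma> :: "('u, 'x, 'g) int_context" +
  fixes \<sigma> :: policy and nxt :: "slice list \<Rightarrow> lane"
  assumes nxt_in: "h \<in> histories \<gamma> \<Longrightarrow> nxt h \<in> lanes_in \<gamma>"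
    and synchronous: "synchronous \<gamma>"
    and next_aware: "next_aware \<gamma> nxt"
    and policy_aware: "policy_aware \<gamma> \<sigma>"
begin

abbreviation in_policy :: "agent \<Rightarrow> ('u, 'x) formula" where
  "in_policy i r m \<equiv> move_in i (env r m) (\<sigma> (run_history \<gamma> r m))"

abbreviation next_lane :: "('u, 'x) run \<Rightarrow> nat \<Rightarrow> lane" where
  "next_lane r m \<equiv> nxt (run_history \<gamma> r m)"

lemma next_lane_less:
  assumes "initial \<gamma> g"
  shows "next_lane (traj P g) m < n_in \<gamma>"
  using nxt_in[OF history_in_histories[OF assms]] by (simp add: run_history_trajectory lanes_in_def)

context
  fixes P g g' i m m'
  assumes P: "protocol \<gamma> P" and g: "initial \<gamma> g" and g': "initial \<gamma> g'" and i: "i \<in> agents \<gamma>"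
    and indist: "loc (traj P g') m' i = loc (traj P g) m i"
begin

lemma indist_time: "m' = m"
  using synchronous P indist i trajectory_in_runs[OF g] trajectory_in_runs[OF g']
  unfolding synchronous_def by metis

lemma indist_sensor:
  "front (env (traj P g') m') i = front (env (traj P g) m) i"
  "lane_of (env (traj P g') m') i = lane_of (env (traj P g) m) i"
  "intent (env (traj P g') m') i = intent (env (traj P g) m) i"
proof -
  have "sensor \<gamma> i (env (traj P g') m') = sensor \<gamma> i (env (traj P g) m)"
    using sensor_trajectory[OF g i, of P m] sensor_trajectory[OF g' i, of P m'] indist by simp
  then show
    "front (env (traj P g') m') i = front (env (traj P g) m) i"
    "lane_of (env (traj P g') m') i = lane_of (env (traj P g) m) i"
    "intent (env (traj P g') m') i = intent (env (traj P g) m) i"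
    by (simp_all add: sensor_def)
qed

lemma indist_next: "next_lane (traj P g') m' = next_lane (traj P g) m"
proof -
  have "next_lane (traj P g) m \<in> lanes_in \<gamma>"
    using next_lane_less[OF g] by (simp add: lanes_in_def)
  then have "knows (runs \<gamma> P) i (\<lambda>r k. next_lane r k = next_lane (traj P g) m) (traj P g) m"
    using next_aware P i trajectory_in_runs[OF g] unfolding next_aware_def valid_def by blast
  then show ?thesis using indist trajectory_in_runs[OF g'] unfolding knows_def by blast
qed

lemma indist_in_policy: "in_policy i (traj P g) m \<Longrightarrow> in_policy i (traj P g') m'"
proof -
  assume "in_policy i (traj P g) m"
  then obtain l where l: "lane_of (env (traj P g) m) i = Val l"
    "(l, intent (env (traj P g) m) i) \<in> \<sigma> (run_history \<gamma> (traj P g) m)"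
    by (auto simp: move_in_def)
  then have "knows (runs \<gamma> P) i
      (\<lambda>r k. (l, intent (env (traj P g) m) i) \<in> \<sigma> (run_history \<gamma> r k)) (traj P g) m"
    using policy_aware P i trajectory_in_runs[OF g] lane_in[OF well_formed_trajectory[OF g] l(1)]
    unfolding policy_aware_def valid_def by blast
  then have "(l, intent (env (traj P g) m) i) \<in> \<sigma> (run_history \<gamma> (traj P g') m')"
    using indist trajectory_in_runs[OF g'] unfolding knows_def by blast
  then show ?thesis using l(1) indist_sensor by (auto simp: move_in_def)
qed

end

text \<open>Awareness speaks only of moves that belong to the policy. Since indistinguishability is
  symmetric, an agent whose move is outside the policy knows this too.\<close>

lemma indist_in_policy_iff:
  assumes "protocol \<gamma> P" "initial \<gamma> g" "initial \<gamma> g'" "i \<in> agents \<gamma>"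
    and "loc (traj P g') m' i = loc (traj P g) m i"
  shows "in_policy i (traj P g') m' \<longleftrightarrow> in_policy i (traj P g) m"
  using indist_in_policy[OF assms] indist_in_policy[OF assms(1,3,2,4) assms(5)[symmetric]] by blast

lemma knows_trajectory:
  assumes "protocol \<gamma> P" "initial \<gamma> g" "i \<in> agents \<gamma>"
  shows "knows (runs \<gamma> P) i \<phi> (traj P g) m \<longleftrightarrow>
    (\<forall>g'. initial \<gamma> g' \<and> loc (traj P g') m i = loc (traj P g) m i \<longrightarrow> \<phi> (traj P g') m)"
    (is "?L \<longleftrightarrow> ?R")
proof
  assume ?L
  then show ?R using trajectory_in_runs unfolding knows_def by blast
next
  assume R: ?R
  show ?L unfolding knows_def
  proof (intro ballI allI impI)
    fix r m'
    assume r: "r \<in> runs \<gamma> P" and eq: "loc r m' i = loc (traj P g) m i"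
    note r = runs_trajectory[OF r]
    have "m' = m" using indist_time[OF assms(1,2) r(1) assms(3)] eq r(2) by metis
    then show "\<phi> r m'" using R eq r by metis
  qed
qed

text \<open>Membership of the own move is known as soon as it holds, so this disjunct yields
  knowledge of the whole test whatever \<open>V\<close> says.\<close>

lemma knows_in_policy:
  assumes "protocol \<gamma> P" "initial \<gamma> g" "i \<in> agents \<gamma>"
    and "front (env (traj P g) m) i" "in_policy i (traj P g) m"
  shows "knows (runs \<gamma> P) i (kbp_optimal \<gamma> \<sigma> nxt i) (traj P g) m"
  unfolding knows_trajectory[OF assms(1-3)] kbp_optimal_def fronting_def
  using assms indist_sensor(1) indist_in_policy by blast


subsection \<open>Ranks\<close>

text \<open>The actions of the agents of stage 0 are fixed by the policy; whether \<open>V\<close> holds for an agent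
  depends only on actions of agents of smaller stage in the same round.  Since an agent knows its
  stage, the rank, which orders the points lexicographically by time and stage, bounds how far
  ahead a test of the program looks.\<close>

definition stage :: "('u, 'x) run \<Rightarrow> nat \<Rightarrow> agent \<Rightarrow> nat" where
  "stage r m i = (case lane_of (env r m) i of
     Val l \<Rightarrow> if in_policy i r m then 0 else Suc (cyclic_distance (n_in \<gamma>) (next_lane r m) l)
   | _ \<Rightarrow> 0)"

definition rank :: "('u, 'x) run \<Rightarrow> nat \<Rightarrow> agent \<Rightarrow> nat" where
  "rank r m i = m * Suc (n_in \<gamma>) + stage r m i"

lemma stage_le: "stage r m i \<le> n_in \<gamma>"
proof -
  have "0 < n_in \<gamma>" using is_context by (simp add: intersection_context_def)
  then have "cyclic_distance (n_in \<gamma>) a b < n_in \<gamma>" for a b by (simp add: cyclic_distance_def)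
  then show ?thesis by (auto simp: stage_def Suc_le_eq split: ext.splits)
qed

text \<open>Stages run from 0 to \<open>n_in \<gamma>\<close>, so a block of
  \<open>Suc (n_in \<gamma>)\<close> ranks per time makes the sum in \<open>rank\<close>
  lexicographic.\<close>

lemma rank_less_Suc: "rank r m i < Suc m * Suc (n_in \<gamma>)"
  using stage_le[of r m i] by (simp add: rank_def)

lemma stage_in_policy: "in_policy i r m \<Longrightarrow> stage r m i = 0"
  by (auto simp: stage_def split: ext.splits)

lemma rank_cong: "traj P g m = traj Q g m \<Longrightarrow> rank (traj P g) m i = rank (traj Q g) m i"
  by (auto simp: rank_def stage_def run_history_trajectory split: ext.splits)

lemma rank_indist:
  assumes "protocol \<gamma> P" "initial \<gamma> g" "initial \<gamma> g'" "i \<in> agents \<gamma>"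
    and "loc (traj P g') m i = loc (traj P g) m i"
  shows "rank (traj P g') m i = rank (traj P g) m i"
  by (simp only: rank_def stage_def indist_in_policy_iff[OF assms] indist_sensor[OF assms]
      indist_next[OF assms])

lemma lane_between_iff:
  assumes "initial \<gamma> g" "lane_of (env (traj P g) m) j = Val l" "lane_of (env (traj P g) m) i = Val l'"
  shows "lane_between \<gamma> (env (traj P g) m) (next_lane (traj P g) m) j i \<longleftrightarrow>
    cyclic_distance (n_in \<gamma>) (next_lane (traj P g) m) l <
    cyclic_distance (n_in \<gamma>) (next_lane (traj P g) m) l'"
  using assms(2,3) lane_in(1)[OF well_formed_trajectory[OF assms(1)] assms(2)]
    cyclic_interval_iff[OF next_lane_less[OF assms(1)]]
  by (simp add: lane_between_def lanes_in_def)

lemma stage_less_between: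
  assumes "initial \<gamma> g" "\<not> in_policy i (traj P g) m" "\<not> in_policy j (traj P g) m"
    and "lane_between \<gamma> (env (traj P g) m) (next_lane (traj P g) m) j i"
  shows "stage (traj P g) m j < stage (traj P g) m i"
proof -
  obtain l l' where "lane_of (env (traj P g) m) j = Val l" "lane_of (env (traj P g) m) i = Val l'"
    using assms(4) by (auto simp: lane_between_def)
  then show ?thesis
    using assms lane_between_iff[OF assms(1)] by (simp add: stage_def)
qed

text \<open>The points are taken from runs of \<open>P\<close> alone, but this favours neither side:
  by \<open>agree_trajectory\<close>, the runs of \<open>Q\<close> are in the same states wherever
  ranks are below \<open>N\<close>.\<close>

definition agree :: "nat \<Rightarrow> ('u, 'x) protocol \<Rightarrow> ('u, 'x) protocol \<Rightarrow> bool" where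
  "agree N P Q \<longleftrightarrow> (\<forall>g m. \<forall>i\<in>agents \<gamma>. initial \<gamma> g \<and> rank (traj P g) m i < N \<longrightarrow>
     P i (loc (traj P g) m i) = Q i (loc (traj P g) m i))"

lemma agreeD:
  "agree N P Q \<Longrightarrow> initial \<gamma> g \<Longrightarrow> i \<in> agents \<gamma> \<Longrightarrow> rank (traj P g) m i < N \<Longrightarrow>
    P i (loc (traj P g) m i) = Q i (loc (traj P g) m i)"
  unfolding agree_def by blast

lemma agree_mono: "agree N P Q \<Longrightarrow> M \<le> N \<Longrightarrow> agree M P Q"
  unfolding agree_def by (meson less_le_trans)

text \<open>The state at time \<open>m\<close> results from actions at earlier times, and their
  ranks are all below \<open>m * Suc (n_in \<gamma>)\<close>.\<close>

lemma agree_trajectory: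
  assumes "agree N P Q" "initial \<gamma> g" "m * Suc (n_in \<gamma>) \<le> N"
  shows "traj P g m = traj Q g m"
  using assms(3)
proof (induction m)
  case (Suc m)
  then have eq: "traj P g m = traj Q g m" by simp
  have "P i (loc (traj P g) m i) = Q i (loc (traj Q g) m i)" if "i \<in> agents \<gamma>" for i
    using agreeD[OF assms(1,2) that, of m] rank_less_Suc[of "traj P g" m i] Suc.prems eq by simp
  then show ?case by (rule trajectory_Suc_cong[OF assms(2) eq])
qed simp

lemma agree_trajectory_rank:
  assumes "agree N P Q" "initial \<gamma> g" "rank (traj P g) m i \<le> N"
  shows "traj P g m = traj Q g m"
  using assms(3) by (intro agree_trajectory[OF assms(1,2)]) (simp add: rank_def)

lemma agree_trajectory_rank':
  assumes "agree N P Q" "initial \<gamma> g" "rank (traj Q g) m i \<le> N"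
  shows "traj P g m = traj Q g m"
  using assms(3) by (intro agree_trajectory[OF assms(1,2)]) (simp add: rank_def)

lemma agree_trans:
  assumes "agree N P Q" "agree N Q R"
  shows "agree N P R"
  unfolding agree_def
proof (intro allI ballI impI)
  fix g m i
  assume i: "i \<in> agents \<gamma>" and *: "initial \<gamma> g \<and> rank (traj P g) m i < N"
  then have "traj P g m = traj Q g m" using agree_trajectory_rank[OF assms(1), of g m i] by simp
  then show "P i (loc (traj P g) m i) = R i (loc (traj P g) m i)"
    using agreeD[OF assms(1)] agreeD[OF assms(2)] * i rank_cong by metis
qed

text \<open>The bound is \<open>\<le> N\<close> here but \<open>< N\<close> in \<open>agree\<close>:
  a test at rank \<open>N\<close> may consult only actions of strictly smaller rank.\<close>

definition rank_determined :: "('u, 'x) kb_program \<Rightarrow> bool" where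
  "rank_determined \<phi> \<longleftrightarrow> (\<forall>N P Q g m. \<forall>i\<in>agents \<gamma>.
     agree N P Q \<and> initial \<gamma> g \<and> rank (traj P g) m i \<le> N \<longrightarrow>
     \<phi> i (traj P g) m = \<phi> i (traj Q g) m)"

lemma rank_determined_policy: "rank_determined (kbp_policy \<gamma> \<sigma>)"
  unfolding rank_determined_def kbp_policy_def fronting_def
  by (metis agree_trajectory_rank run_history_trajectory)

lemma rank_determined_optimal: "rank_determined (kbp_optimal \<gamma> \<sigma> nxt)"
  unfolding rank_determined_def
proof (intro allI ballI impI)
  fix N P Q g m i
  assume i: "i \<in> agents \<gamma>" and *: "agree N P Q \<and> initial \<gamma> g \<and> rank (traj P g) m i \<le> N"
  then have g: "initial \<gamma> g" and eq: "traj P g m = traj Q g m"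
    using agree_trajectory_rank by blast+
  have hist: "run_history \<gamma> (traj P g) m = run_history \<gamma> (traj Q g) m"
    by (simp add: run_history_trajectory)
  have going: "going j (traj P g) m = going j (traj Q g) m"
    if "j \<in> agents \<gamma>" "stage (traj P g) m j < stage (traj P g) m i" for j
  proof -
    have "rank (traj P g) m j < N" using that(2) * by (simp add: rank_def)
    then have "P j (loc (traj P g) m j) = Q j (loc (traj P g) m j)"
      using agreeD * that(1) by blast
    then show ?thesis by (simp add: going_trajectory[OF g] eq)
  qed
  \<comment> \<open>Clause (a) of \<open>V\<close> refers to policy agents in any lane. They have
    stage 0, whereas an agent at the front outside the policy is in a lane and so has positive
    stage.\<close>
  have "stage (traj P g) m j < stage (traj P g) m i"
    if "fronting i (traj P g) m" "\<not> in_policy i (traj P g) m" "in_policy j (traj P g) m" for j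
  proof -
    have "front (env (traj P g) m) i" using that(1) by (simp add: fronting_def)
    then obtain l where "lane_of (env (traj P g) m) i = Val l"
      by (rule front_lane[OF well_formed_trajectory[OF g]])
    then have "0 < stage (traj P g) m i" using that(2) by (simp add: stage_def)
    then show ?thesis using stage_in_policy[OF that(3)] by simp
  qed
  then have "V \<gamma> \<sigma> nxt i (traj P g) m = V \<gamma> \<sigma> nxt i (traj Q g) m" if "fronting i (traj P g) m"
    unfolding V_def eq[symmetric] hist[symmetric]
    using going stage_less_between[OF g] that by blast
  then show "kbp_optimal \<gamma> \<sigma> nxt i (traj P g) m = kbp_optimal \<gamma> \<sigma> nxt i (traj Q g) m"
    unfolding kbp_optimal_def using eq hist by (auto simp: fronting_def)
qed

text \<open>All points relevant to the knowledge of \<open>i\<close> have the same time, where both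
  systems are in the same states, and the same rank, so the assumption on \<open>\<phi>\<close>
  applies at each of them.\<close>

lemma knows_cong:
  assumes \<phi>: "rank_determined \<phi>"
    and P: "protocol \<gamma> P" and Q: "protocol \<gamma> Q" and ag: "agree N P Q"
    and g: "initial \<gamma> g" and i: "i \<in> agents \<gamma>" and rk: "rank (traj P g) m i \<le> N"
  shows "knows (runs \<gamma> P) i (\<phi> i) (traj P g) m = knows (runs \<gamma> Q) i (\<phi> i) (traj Q g) m"
proof -
  have "m * Suc (n_in \<gamma>) \<le> N" using rk by (simp add: rank_def)
  then have eq: "traj P g' m = traj Q g' m" if "initial \<gamma> g'" for g'
    using agree_trajectory[OF ag that] by blast
  have "\<phi> i (traj P g') m = \<phi> i (traj Q g') m"
    if "initial \<gamma> g'" "loc (traj P g') m i = loc (traj P g) m i" for g'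
    using \<phi> ag i that rk rank_indist[OF P g that(1) i that(2)] unfolding rank_determined_def
    by metis
  then show ?thesis
    unfolding knows_trajectory[OF P g i] knows_trajectory[OF Q g i] using eq g by metis
qed


subsection \<open>Existence and uniqueness of implementations\<close>

context
  fixes \<phi> :: "('u, 'x) kb_program"
  assumes det: "rank_determined \<phi>"
    and fronting: "\<And>i r m. \<phi> i r m \<Longrightarrow> fronting i r m"
begin

text \<open>Plays the tests as evaluated in the system of \<open>P\<close>, with \<open>Noop\<close>
  at states that \<open>P\<close> does not reach. The guard \<open>front_s\<close> yields a protocol
  whatever \<open>P\<close> is. Which point realises \<open>s\<close> is irrelevant, as knowledge
  depends on the local state only.\<close>

definition refine :: "('u, 'x) protocol \<Rightarrow> ('u, 'x) protocol" where
  "refine P i s = (if front_s (snd s) \<and>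
     (\<exists>g m. initial \<gamma> g \<and> loc (traj P g) m i = s \<and> knows (runs \<gamma> P) i (\<phi> i) (traj P g) m)
     then Go else Noop)"

lemma protocol_refine: "protocol \<gamma> (refine P)"
  by (simp add: protocol_def refine_def)

lemma refine_Go_iff:
  assumes "initial \<gamma> g" "i \<in> agents \<gamma>"
  shows "refine P i (loc (traj P g) m i) = Go \<longleftrightarrow> knows (runs \<gamma> P) i (\<phi> i) (traj P g) m"
proof
  assume "refine P i (loc (traj P g) m i) = Go"
  then show "knows (runs \<gamma> P) i (\<phi> i) (traj P g) m"
    by (auto simp: refine_def knows_def split: if_splits)
next
  assume K: "knows (runs \<gamma> P) i (\<phi> i) (traj P g) m"
  then have "fronting i (traj P g) m"
    using fronting trajectory_in_runs[OF assms(1)] unfolding knows_def by blast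
  then have "front_s (snd (loc (traj P g) m i))"
    by (simp only: sensor_trajectory[OF assms]) (simp add: sensor_def fronting_def)
  moreover have "\<exists>g' m'. initial \<gamma> g' \<and> loc (traj P g') m' i = loc (traj P g) m i \<and>
      knows (runs \<gamma> P) i (\<phi> i) (traj P g') m'"
    using K assms(1) by blast
  ultimately show "refine P i (loc (traj P g) m i) = Go"
    by (simp only: refine_def) simp
qed

text \<open>Each refinement makes the protocol stable on one more rank, so an implementation is obtained
  as the limit, although the test of the program refers to the protocol being defined.\<close>

definition approx :: "nat \<Rightarrow> ('u, 'x) protocol" where
  "approx k = (refine ^^ k) (\<lambda>_ _. Noop)"

lemma approx_Suc: "approx (Suc k) = refine (approx k)"
  by (simp add: approx_def)

lemma protocol_approx: "protocol \<gamma> (approx k)"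
proof (cases k)
  case 0
  then show ?thesis by (simp add: approx_def protocol_def)
qed (simp add: approx_Suc protocol_refine)

text \<open>If two consecutive approximants agree below \<open>k\<close>, the tests in their systems
  coincide up to and including rank \<open>k\<close>; so their refinements agree below
  \<open>Suc k\<close>.\<close>

lemma agree_approx_Suc: "agree k (approx k) (approx (Suc k))"
proof (induction k)
  case 0
  then show ?case by (simp add: agree_def)
next
  case (Suc k)
  show ?case unfolding agree_def
  proof (intro allI ballI impI)
    fix g m i
    assume i: "i \<in> agents \<gamma>" and *: "initial \<gamma> g \<and> rank (traj (approx (Suc k)) g) m i < Suc k"
    then have g: "initial \<gamma> g" and "rank (traj (approx (Suc k)) g) m i \<le> k" by auto
    then have eq: "traj (approx k) g m = traj (approx (Suc k)) g m"
      and rk: "rank (traj (approx k) g) m i \<le> k"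
      using agree_trajectory_rank'[OF Suc.IH g] rank_cong by metis+
    have "approx (Suc k) i (loc (traj (approx (Suc k)) g) m i) = Go \<longleftrightarrow>
        knows (runs \<gamma> (approx k)) i (\<phi> i) (traj (approx k) g) m"
      using refine_Go_iff[OF g i, of "approx k" m] eq by (simp add: approx_Suc)
    also have "\<dots> \<longleftrightarrow> knows (runs \<gamma> (approx (Suc k))) i (\<phi> i) (traj (approx (Suc k)) g) m"
      by (rule knows_cong[OF det protocol_approx protocol_approx Suc.IH g i rk])
    also have "\<dots> \<longleftrightarrow> approx (Suc (Suc k)) i (loc (traj (approx (Suc k)) g) m i) = Go"
      using refine_Go_iff[OF g i] by (simp add: approx_Suc)
    finally show "approx (Suc k) i (loc (traj (approx (Suc k)) g) m i) =
        approx (Suc (Suc k)) i (loc (traj (approx (Suc k)) g) m i)"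
      by (rule action_eqI)
  qed
qed

lemma agree_approx: "k \<le> l \<Longrightarrow> agree k (approx k) (approx l)"
proof (induction l rule: dec_induct)
  case base
  then show ?case by (simp add: agree_def)
next
  case (step l)
  then show ?case using agree_trans agree_mono[OF agree_approx_Suc] by blast
qed

text \<open>The eventual action. At a state occurring in a run of \<open>approx k\<close> with rank
  below \<open>k\<close> the sequence is constant from \<open>k\<close> on; wherever it does not
  settle on \<open>Go\<close>, the value is \<open>Noop\<close>.\<close>

definition limit :: "('u, 'x) protocol" where
  "limit i s = (if \<exists>k. \<forall>l\<ge>k. approx l i s = Go then Go else Noop)"

lemma protocol_limit: "protocol \<gamma> limit"
  using protocol_approx unfolding protocol_def limit_def by (metis action.distinct(1) order_refl)

lemma agree_limit: "agree k (approx k) limit"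
  unfolding agree_def
proof (intro allI ballI impI)
  fix g m i
  assume i: "i \<in> agents \<gamma>" and *: "initial \<gamma> g \<and> rank (traj (approx k) g) m i < k"
  let ?s = "loc (traj (approx k) g) m i"
  have const: "approx l i ?s = approx k i ?s" if "l \<ge> k" for l
    using agreeD[OF agree_approx[OF that]] i * by metis
  show "approx k i ?s = limit i ?s"
  proof (cases "approx k i ?s")
    case Go
    then have "approx l i ?s = Go" if "l \<ge> k" for l using const[OF that] by simp
    then have "\<exists>n. \<forall>l\<ge>n. approx l i ?s = Go" by blast
    then show ?thesis unfolding limit_def using Go by simp
  next
    case Noop
    then have "approx (max k n) i ?s \<noteq> Go" for n using const[of "max k n"] by simp
    then have "\<not> (\<exists>n. \<forall>l\<ge>n. approx l i ?s = Go)" by (meson max.cobounded2)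
    then show ?thesis unfolding limit_def using Noop by simp
  qed
qed

lemma limit_implements: "implements \<gamma> \<phi> limit"
  unfolding implements_def
proof (intro conjI protocol_limit ballI allI)
  fix r m i
  assume r: "r \<in> runs \<gamma> limit" and i: "i \<in> agents \<gamma>"
  define g where "g = r 0"
  have g: "initial \<gamma> g" and r: "r = traj limit g"
    using runs_trajectory[OF r] by (simp_all add: g_def)
  \<comment> \<open>With \<open>N\<close> just above the rank of the point, \<open>approx N\<close>
    agrees there both with \<open>limit\<close> and with its own refinement.\<close>
  define N where "N = Suc (rank (traj limit g) m i)"
  have "traj (approx N) g m = traj limit g m"
    using agree_trajectory_rank'[OF agree_limit g, of m i N] by (simp add: N_def)
  then have eq: "loc (traj (approx N) g) m i = loc (traj limit g) m i"
    and rk: "rank (traj (approx N) g) m i < N"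
    using rank_cong[of "approx N" g m limit i] by (simp_all add: N_def)
  have "limit i (loc r m i) = approx N i (loc (traj (approx N) g) m i)"
    using agreeD[OF agree_limit g i rk] eq r by simp
  also have "\<dots> = refine (approx N) i (loc (traj (approx N) g) m i)"
    using agreeD[OF agree_approx_Suc g i rk] by (simp add: approx_Suc)
  finally have "limit i (loc r m i) = Go \<longleftrightarrow>
      knows (runs \<gamma> (approx N)) i (\<phi> i) (traj (approx N) g) m"
    using refine_Go_iff[OF g i] by simp
  also have "\<dots> \<longleftrightarrow> knows (runs \<gamma> limit) i (\<phi> i) (traj limit g) m"
    using rk by (intro knows_cong[OF det protocol_approx protocol_limit agree_limit g i]) simp
  finally show "limit i (loc r m i) = Go \<longleftrightarrow> knows (runs \<gamma> limit) i (\<phi> i) r m"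
    by (simp add: r)
qed

text \<open>The induction of \<open>agree_approx_Suc\<close> again: an implementation is its own
  refinement at its reachable states.\<close>

lemma agree_implementations:
  assumes "implements \<gamma> \<phi> P" "implements \<gamma> \<phi> Q"
  shows "agree N P Q"
proof (induction N)
  case 0
  then show ?case by (simp add: agree_def)
next
  case (Suc N)
  have P: "protocol \<gamma> P" and Q: "protocol \<gamma> Q"
    using assms by (simp_all add: implements_def)
  show ?case unfolding agree_def
  proof (intro allI ballI impI)
    fix g m i
    assume i: "i \<in> agents \<gamma>" and *: "initial \<gamma> g \<and> rank (traj P g) m i < Suc N"
    then have g: "initial \<gamma> g" and rk: "rank (traj P g) m i \<le> N" by auto
    have eq: "traj P g m = traj Q g m" by (rule agree_trajectory_rank[OF Suc.IH g rk])
    have "P i (loc (traj P g) m i) = Go \<longleftrightarrow> knows (runs \<gamma> P) i (\<phi> i) (traj P g) m"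
      using assms(1) i trajectory_in_runs[OF g] unfolding implements_def by blast
    also have "\<dots> \<longleftrightarrow> knows (runs \<gamma> Q) i (\<phi> i) (traj Q g) m"
      by (rule knows_cong[OF det P Q Suc.IH g i rk])
    also have "\<dots> \<longleftrightarrow> Q i (loc (traj P g) m i) = Go"
      using assms(2) i trajectory_in_runs[OF g] eq unfolding implements_def by metis
    finally show "P i (loc (traj P g) m i) = Q i (loc (traj P g) m i)" by (rule action_eqI)
  qed
qed

lemma unique_implementation: "unique_implementation_exists \<gamma> \<phi>"
proof -
  have half: "P i (loc r m i) = Q i (loc r m i)"
    if "implements \<gamma> \<phi> P" "implements \<gamma> \<phi> Q" "r \<in> runs \<gamma> P" "i \<in> agents \<gamma>" for P Q r m i
    using agreeD[OF agree_implementations[OF that(1,2)] runs_trajectory(1)[OF that(3)] that(4)]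
      runs_trajectory(2)[OF that(3)] lessI by metis
  have "agree_on_reachable \<gamma> P Q" if "implements \<gamma> \<phi> P" "implements \<gamma> \<phi> Q" for P Q
    unfolding agree_on_reachable_def
    using half[OF that] half[OF that(2,1)] by (metis UnE)
  then show ?thesis
    unfolding unique_implementation_exists_def using limit_implements by blast
qed

end


subsection \<open>Safety, liveness and domination\<close>

lemma implements_Go_iff:
  assumes "implements \<gamma> \<phi> P" "initial \<gamma> g" "i \<in> agents \<gamma>"
  shows "P i (loc (traj P g) m i) = Go \<longleftrightarrow> knows (runs \<gamma> P) i (\<phi> i) (traj P g) m"
  using assms trajectory_in_runs[OF assms(2)] unfolding implements_def by blast

lemma implements_Go:
  assumes "implements \<gamma> \<phi> P" "initial \<gamma> g" "i \<in> agents \<gamma>" "P i (loc (traj P g) m i) = Go"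
  shows "\<phi> i (traj P g) m"
  using implements_Go_iff[OF assms(1-3)] assms(4) trajectory_in_runs[OF assms(2)]
  unfolding knows_def by blast

lemma moves_compatible_sym: "moves_compatible \<gamma> s i j \<Longrightarrow> moves_compatible \<gamma> s j i"
  using is_context unfolding moves_compatible_def intersection_context_def by (metis symE)

context
  fixes P
  assumes impl: "implements \<gamma> (kbp_optimal \<gamma> \<sigma> nxt) P"
begin

lemma protocol_impl: "protocol \<gamma> P"
  using impl by (simp add: implements_def)

lemma safety_impl:
  assumes conflict_free: "conflict_free \<gamma> \<sigma>"
  shows "safety \<gamma> P"
  unfolding safety_def valid_def
proof (intro ballI impI allI)
  fix i j r m
  assume ij: "i \<in> agents \<gamma>" "j \<in> agents \<gamma>" "i \<noteq> j" and r: "r \<in> runs \<gamma> P"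
    and going: "going i r m \<and> going j r m"
  define g where "g = r 0"
  have g: "initial \<gamma> g" and r: "r = traj P g"
    using runs_trajectory[OF r] by (simp_all add: g_def)
  have wf: "well_formed \<gamma> (env r m)" using well_formed_trajectory[OF g] by (simp add: r)
  have fr: "front (env r m) i" "front (env r m) j"
    using going going_trajectory[OF g] by (auto simp: r)
  have \<phi>: "kbp_optimal \<gamma> \<sigma> nxt k r m" if "going k r m" "k \<in> agents \<gamma>" for k
    using that implements_Go[OF impl g] going_trajectory[OF g] by (auto simp: r)
  obtain l where l: "lane_of (env r m) i = Val l" by (rule front_lane[OF wf fr(1)])
  obtain l' where l': "lane_of (env r m) j = Val l'" by (rule front_lane[OF wf fr(2)])
  \<comment> \<open>Needed twice: conflict-freeness says nothing about a move and itself, and cyclic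
    distances differ only for different lanes.\<close>
  have ne: "l \<noteq> l'" by (rule fronts_distinct_lanes[OF wf fr ij(3) l l'])
  consider "in_policy i r m" "in_policy j r m"
    | "in_policy i r m" "\<not> in_policy j r m"
    | "\<not> in_policy i r m" "in_policy j r m"
    | "\<not> in_policy i r m" "\<not> in_policy j r m" by blast
  then show "moves_compatible \<gamma> (env r m) i j"
  proof cases
    case 1
    then have "(l, intent (env r m) i) \<in> \<sigma> (run_history \<gamma> r m)"
      "(l', intent (env r m) j) \<in> \<sigma> (run_history \<gamma> r m)"
      using l l' by (auto simp: move_in_def)
    moreover have "run_history \<gamma> r m \<in> histories \<gamma>"
      using history_in_histories[OF g] by (simp add: r run_history_trajectory)
    ultimately have "((l, intent (env r m) i), (l', intent (env r m) j)) \<in> compat \<gamma>"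
      using conflict_free ne unfolding conflict_free_def by blast
    then show ?thesis using l l' by (simp add: moves_compatible_def)
  next
    case 2
    then have "V \<gamma> \<sigma> nxt j r m" using \<phi>[of j] going ij by (simp add: kbp_optimal_def)
    then show ?thesis using 2 going ij moves_compatible_sym by (auto simp: V_def)
  next
    case 3
    then have "V \<gamma> \<sigma> nxt i r m" using \<phi>[of i] going ij by (simp add: kbp_optimal_def)
    then show ?thesis using 3 going ij by (auto simp: V_def)
  next
    case 4
    then have V: "V \<gamma> \<sigma> nxt i r m" "V \<gamma> \<sigma> nxt j r m"
      using \<phi>[of i] \<phi>[of j] going ij by (simp_all add: kbp_optimal_def)
    let ?d = "cyclic_distance (n_in \<gamma>) (next_lane r m)"
    have "l < n_in \<gamma>" "l' < n_in \<gamma>"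
      using lane_in(1)[OF wf l] lane_in(1)[OF wf l'] by (simp_all add: lanes_in_def)
    then have "?d l \<noteq> ?d l'"
      using ne cyclic_distance_inj next_lane_less[OF g] unfolding r by metis
    then consider "?d l' < ?d l" | "?d l < ?d l'" by linarith
    then show ?thesis
    proof cases
      case 1
      then have "lane_between \<gamma> (env r m) (next_lane r m) j i"
        using lane_between_iff[OF g] l l' unfolding r by blast
      then show ?thesis using V(1) 4 going ij by (auto simp: V_def)
    next
      case 2
      then have "lane_between \<gamma> (env r m) (next_lane r m) i j"
        using lane_between_iff[OF g] l l' unfolding r by blast
      then show ?thesis using V(2) 4 going ij moves_compatible_sym by (auto simp: V_def)
    qed
  qed
qed

lemma liveness_impl:
  assumes fair: "fair \<gamma> \<sigma>"
  shows "liveness \<gamma> P"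
  unfolding liveness_def valid_def
proof (intro ballI allI impI)
  fix i r m
  assume i: "i \<in> agents \<gamma>" and r: "r \<in> runs \<gamma> P" and front: "fronting i r m"
  define g where "g = r 0"
  have g: "initial \<gamma> g" and r: "r = traj P g"
    using runs_trajectory[OF r] by (simp_all add: g_def)
  have wf: "well_formed \<gamma> (env r k)" for k using well_formed_trajectory[OF g] by (simp add: r)
  let ?\<alpha> = "adv (fst g)"
  \<comment> \<open>The move is read off the adversary and not off a state, so fairness applies to
    it before it is known where the agent is at \<open>m'\<close>. The agent never changes its lane
    while queued, so \<open>a\<close> is still its move if it is at the front then.\<close>
  define a where "a = snd (arrival ?\<alpha> i)"
  have \<alpha>: "?\<alpha> \<in> model \<gamma>" using g by (auto simp: initial_def)
  have "a \<in> moves \<gamma>" using arrival_range[OF \<alpha> i] by (simp add: a_def moves_def mem_Times_iff)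
  then obtain m' where m': "m' \<ge> m" "a \<in> \<sigma> (history \<gamma> ?\<alpha> m')"
    using fair \<alpha> unfolding fair_def by blast
  have in_policy: "in_policy i r m'" if "fronting i r m'"
  proof -
    have "front (env r m') i" using that by (simp add: fronting_def)
    then obtain l where l: "lane_of (env r m') i = Val l" by (rule front_lane[OF wf])
    then have "l = fst a"
      using lane_of_iff[OF wf] well_formed_queue(4)[OF wf] adv_trajectory[of \<gamma> P g]
      by (metis a_def r)
    moreover have "intent (env r m') i = snd a"
      by (simp add: intent_def a_def r adv_trajectory)
    ultimately show ?thesis
      using l m'(2) by (simp add: move_in_def r run_history_trajectory)
  qed
  show "eventually_true (going i) r m"
  proof (rule ccontr)
    assume "\<not> eventually_true (going i) r m"
    then have stay: "\<not> going i r k" if "k \<ge> m" for k using that by (auto simp: eventually_true_def)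
    have "fronting i r m'"
      using m'(1)
    proof (induction m' rule: dec_induct)
      case base
      then show ?case by (rule front)
    next
      case (step k)
      then show ?case using stay[of k] by (auto simp: going_def next_time_def)
    qed
    then have "knows (runs \<gamma> P) i (kbp_optimal \<gamma> \<sigma> nxt i) (traj P g) m'"
      using knows_in_policy[OF protocol_impl g i] in_policy r by (auto simp: fronting_def)
    then have "going i r m'"
      using implements_Go_iff[OF impl g i] \<open>fronting i r m'\<close> going_trajectory[OF g]
      by (simp add: r fronting_def)
    then show False using stay m'(1) by blast
  qed
qed

lemma dominates_policy_impl:
  assumes Q: "implements \<gamma> (kbp_policy \<gamma> \<sigma>) Q"
  shows "lex_dominates \<gamma> P Q"
  unfolding lex_dominates_def
proof (intro ballI impI)
  fix r r'
  assume r: "r \<in> runs \<gamma> P" and r': "r' \<in> runs \<gamma> Q" and "r 0 = r' 0"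
  define g where "g = r 0"
  have g: "initial \<gamma> g" and r: "r = traj P g" and r': "r' = traj Q g"
    using runs_trajectory[OF r] runs_trajectory[OF r'] \<open>r 0 = r' 0\<close> by (simp_all add: g_def)
  have pQ: "protocol \<gamma> Q" using Q by (simp add: implements_def)
  show "(\<forall>m. GO \<gamma> r m = GO \<gamma> r' m) \<or>
    (\<exists>m. (\<forall>n<m. GO \<gamma> r n = GO \<gamma> r' n) \<and> GO \<gamma> r' m \<subset> GO \<gamma> r m)"
  proof (cases "\<forall>m. GO \<gamma> r m = GO \<gamma> r' m")
    case False
    then obtain m where m: "GO \<gamma> r m \<noteq> GO \<gamma> r' m" "\<forall>n<m. GO \<gamma> r n = GO \<gamma> r' n"
      using exists_least_iff[of "\<lambda>m. GO \<gamma> r m \<noteq> GO \<gamma> r' m"] by auto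
    \<comment> \<open>At the first difference both runs are in one state, so an agent going under
      \<open>Q\<close> has its move in the policy at the point of \<open>P\<close> as well.\<close>
    have eq: "traj P g m = traj Q g m"
      using m(2) trajectory_eq_if_GO_eq[OF protocol_impl pQ g] unfolding r r' by blast
    have "GO \<gamma> r' m \<subseteq> GO \<gamma> r m"
    proof
      fix i assume "i \<in> GO \<gamma> r' m"
      then have i: "i \<in> agents \<gamma>" and "Q i (loc (traj Q g) m i) = Go"
        by (auto simp: r' GO_trajectory[OF pQ g])
      then have "kbp_policy \<gamma> \<sigma> i (traj Q g) m" using implements_Go[OF Q g] by blast
      then have "front (env (traj P g) m) i" "in_policy i (traj P g) m"
        by (simp_all add: kbp_policy_def fronting_def eq run_history_trajectory)
      then have "P i (loc (traj P g) m i) = Go"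
        using knows_in_policy[OF protocol_impl g i] implements_Go_iff[OF impl g i] by blast
      then show "i \<in> GO \<gamma> r m" using i by (simp add: r GO_trajectory[OF protocol_impl g])
    qed
    then show ?thesis using m by blast
  qed simp
qed

text \<open>A first difference cannot occur before \<open>m\<close>. If it occurs at
  \<open>m\<close>, domination gives the inclusion; if later or never, the two sets are
  equal.\<close>

lemma GO_subset_if_dominated:
  assumes "lex_dominates \<gamma> Q P" "initial \<gamma> g"
    and "\<And>k. k < m \<Longrightarrow> GO \<gamma> (traj Q g) k = GO \<gamma> (traj P g) k"
  shows "GO \<gamma> (traj P g) m \<subseteq> GO \<gamma> (traj Q g) m"
proof -
  consider "\<forall>m. GO \<gamma> (traj Q g) m = GO \<gamma> (traj P g) m"
    | k where "\<forall>n<k. GO \<gamma> (traj Q g) n = GO \<gamma> (traj P g) n"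
        "GO \<gamma> (traj P g) k \<subset> GO \<gamma> (traj Q g) k"
    using assms(1) trajectory_in_runs[OF assms(2)] unfolding lex_dominates_def
    by (metis trajectory_0)
  then show ?thesis
  proof cases
    case 2
    then have "\<not> k < m" using assms(3) by blast
    then show ?thesis using 2 by (metis linorder_neqE_nat order_refl psubset_imp_subset)
  qed simp
qed

text \<open>If a safe protocol that dominates \<open>P\<close> lets an agent go that waits under \<open>P\<close>, then this agent
  considers a point possible at which it would collide with an agent going under \<open>P\<close>; by
  dominance the latter also goes under the other protocol, at a point with the same states.\<close>

lemma GO_eq_if_dominated:
  assumes Q: "protocol \<gamma> Q" "safety \<gamma> Q" and dom: "lex_dominates \<gamma> Q P" and "initial \<gamma> g"
  shows "GO \<gamma> (traj Q g) m = GO \<gamma> (traj P g) m"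
  using assms(4)
proof (induction m arbitrary: g rule: less_induct)
  case (less m g)
  \<comment> \<open>Stated for every initial state, since the point at which the test fails may
    belong to another run than that of \<open>g\<close>.\<close>
  have sub: "GO \<gamma> (traj P g') m \<subseteq> GO \<gamma> (traj Q g') m" if "initial \<gamma> g'" for g'
    using GO_subset_if_dominated[OF dom that] less.IH[OF _ that] by blast
  have eq: "traj Q g' m = traj P g' m" if "initial \<gamma> g'" for g'
    using trajectory_eq_if_GO_eq[OF Q(1) protocol_impl that] less.IH[OF _ that] by blast
  note g = less.prems
  have "i \<in> GO \<gamma> (traj P g) m" if "i \<in> GO \<gamma> (traj Q g) m" for i
  proof (rule ccontr)
    assume "i \<notin> GO \<gamma> (traj P g) m"
    have i: "i \<in> agents \<gamma>" and Go: "Q i (loc (traj Q g) m i) = Go"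
      using that by (auto simp: GO_trajectory[OF Q(1) g])
    have "\<not> knows (runs \<gamma> P) i (kbp_optimal \<gamma> \<sigma> nxt i) (traj P g) m"
      using \<open>i \<notin> GO \<gamma> (traj P g) m\<close> i implements_Go_iff[OF impl g i]
      by (simp add: GO_trajectory[OF protocol_impl g])
    then obtain g' where g': "initial \<gamma> g'" "loc (traj P g') m i = loc (traj P g) m i"
      "\<not> kbp_optimal \<gamma> \<sigma> nxt i (traj P g') m"
      unfolding knows_trajectory[OF protocol_impl g i] by blast
    have "Q i (loc (traj Q g') m i) = Go" using Go g' eq[OF g] eq[OF g'(1)] by simp
    then have iQ: "i \<in> GO \<gamma> (traj Q g') m" using i by (simp add: GO_trajectory[OF Q(1) g'(1)])
    then have "fronting i (traj P g') m"
      using eq[OF g'(1)] by (simp add: GO_def going_def fronting_def)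
    then have "\<not> in_policy i (traj P g') m" "\<not> V \<gamma> \<sigma> nxt i (traj P g') m"
      using g'(3) by (simp_all add: kbp_optimal_def)
    \<comment> \<open>Clause (a) of \<open>V\<close> does not ask for \<open>j \<noteq> i\<close>;
      there the two differ because the move of \<open>j\<close> is in the policy and that of
      \<open>i\<close> is not.\<close>
    then obtain j where j: "j \<in> agents \<gamma>" "j \<noteq> i" "going j (traj P g') m"
      "\<not> moves_compatible \<gamma> (env (traj P g') m) i j"
      unfolding V_def by metis
    then have "j \<in> GO \<gamma> (traj Q g') m" using sub[OF g'(1)] by (auto simp: GO_def)
    then have going: "going i (traj Q g') m \<and> going j (traj Q g') m"
      using iQ by (simp add: GO_def)
    have "valid (runs \<gamma> Q)
        (\<lambda>r m. going i r m \<and> going j r m \<longrightarrow> moves_compatible \<gamma> (env r m) i j)"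
      by (rule Q(2)[unfolded safety_def, rule_format, OF i j(1) j(2)[symmetric]])
    then have "moves_compatible \<gamma> (env (traj Q g') m) i j"
      using going trajectory_in_runs[OF g'(1)] by (simp add: valid_def)
    then show False using j(4) eq[OF g'(1)] by simp
  qed
  then show ?case using sub[OF g] by blast
qed

text \<open>A dominating intersection protocol has the same \<open>GO\<close> sets in all
  corresponding runs, so \<open>P\<close> dominates it in turn and strictness fails.\<close>

lemma lex_optimal_impl: "lex_optimal \<gamma> P"
  unfolding lex_optimal_def
proof
  assume "\<exists>Q. intersection_protocol \<gamma> Q \<and> strictly_lex_dominates \<gamma> Q P"
  then obtain Q where Q: "protocol \<gamma> Q" "safety \<gamma> Q" and dom: "lex_dominates \<gamma> Q P"
    and not_dom: "\<not> lex_dominates \<gamma> P Q"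
    by (auto simp: intersection_protocol_def strictly_lex_dominates_def)
  have "GO \<gamma> r m = GO \<gamma> r' m" if "r \<in> runs \<gamma> P" "r' \<in> runs \<gamma> Q" "r 0 = r' 0" for r r' m
    using GO_eq_if_dominated[OF Q dom runs_trajectory(1)[OF that(1)]]
      runs_trajectory(2)[OF that(1)] runs_trajectory(2)[OF that(2)] that(3) by metis
  then show False using not_dom unfolding lex_dominates_def by blast
qed

end

end

theorem proposition19:
  fixes \<gamma> :: "('u, 'x, 'g) int_context"
    and \<sigma> :: policy
    and nxt :: "slice list \<Rightarrow> lane"
  assumes "intersection_context \<gamma>"
    and "intersection_policy \<gamma> \<sigma>"
    and "conflict_free \<gamma> \<sigma>"
    and "\<forall>h\<in>histories \<gamma>. nxt h \<in> lanes_in \<gamma>"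
    and "synchronous \<gamma>"
    and "next_aware \<gamma> nxt"
    and "policy_aware \<gamma> \<sigma>"
  shows "unique_implementation_exists \<gamma> (kbp_optimal \<gamma> \<sigma> nxt) \<and>
    unique_implementation_exists \<gamma> (kbp_policy \<gamma> \<sigma>) \<and>
    (\<forall>P. implements \<gamma> (kbp_optimal \<gamma> \<sigma> nxt) P \<longrightarrow>
       safety \<gamma> P \<and> validity \<gamma> P \<and> lex_optimal \<gamma> P \<and>
       (\<forall>Q. implements \<gamma> (kbp_policy \<gamma> \<sigma>) Q \<longrightarrow> lex_dominates \<gamma> P Q) \<and>
       (fair \<gamma> \<sigma> \<longrightarrow> liveness \<gamma> P))"
proof -
  interpret aware_crossing \<gamma> \<sigma> nxt
    using assms by unfold_locales auto
  have "unique_implementation_exists \<gamma> (kbp_optimal \<gamma> \<sigma> nxt)"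
    by (rule unique_implementation[OF rank_determined_optimal]) (simp add: kbp_optimal_def)
  moreover have "unique_implementation_exists \<gamma> (kbp_policy \<gamma> \<sigma>)"
    by (rule unique_implementation[OF rank_determined_policy]) (simp add: kbp_policy_def)
  moreover have "validity \<gamma> P" for P
    by (simp add: validity_def valid_def going_def)
  ultimately show ?thesis
    using safety_impl[OF _ assms(3)] lex_optimal_impl dominates_policy_impl liveness_impl by blast
qed

end
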